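(* Consider the two-stage problem $\inf_{x\in\mathcal X}f_0(x)+\mathbb E[f(\xi,x)]$ with $$f(\xi,x)=\inf_y\{g(\xi,y): W_\xi y+T_\xi x=h_\xi,\ y\ge 0\},$$ and assume there are only finitely many distinct values of $W_\xi$ and of $T_\xi$, i.e. $|\{W_\xi\}|=p$ and $|\{T_\xi\}|=q$ with $p,q\in\mathbb Z^+$. Let $W_1,\dots,W_p$ be the distinct values of $W_\xi$, let $|J_i|$ be the number of non-equivalent extreme rays of the polyhedral cone $\{a:a^TW_i\ge0\}$, and let $|J|=\max_{i\in\{1,\dots,p\}}|J_i|$. Let $\xi^{[N]}=(\xi_1,\dots,\xi_N)$ be IID samples from $\mathbb P$ (so $\xi^{[N]}\sim\mathbb P^N$), and let $x^\star(\xi^{[N]})$ be the output of any algorithm that is guaranteed to be within the feasible region of SAA. Set $$d_{VC}=\frac{e}{(e-1)\log 2}\,|J|(n+1)\log\Big(\frac{e}{\log 2}\cdot|J|\Big).$$ Then, for any $0<\delta,\epsilon<1$, if $$N\ge\frac4\epsilon\Big(d_{VC}\log\big(\tfrac{12}{\epsilon}\big)+\log\big(\tfrac2\delta\big)\Big),$$ we have $\mathbb P^N\big(V(x^\star(\xi^{[N]}))>\epsilon\big)\le\delta$. Equivalently, in terms of convergence rate, $$\mathbb P^N\big(V(x^\star(\xi^{[N]}))>\epsilon\big)\le 2\exp\Big(-\frac{N\epsilon}{4}\Big)\Big(\frac{12}{\epsilon}\Big)^{d_{VC}}.$$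
   Context: Setting. $(\Omega,\mathcal F,\mathbb P)$ is a complete probability space and $\xi:\Omega\to\Xi\subseteq\mathbb R^r$ a random vector ($\mathbb P$ also denotes its law). $\mathcal X\subseteq\mathbb R^n$ is nonempty and closed. $f_0$ is a deterministic real-valued function of $x$. $W_\xi,T_\xi$ are matrices and $h_\xi$ a vector, of compatible sizes, depending on $\xi$. The function $g(\xi,\cdot)$ is convex and finite everywhere, for almost every $\xi\in\Xi$. The infimum over an empty set is $+\infty$. It is assumed that $f$ takes values in $\mathbb R\cup\{+\infty\}$, that $f(\xi,\cdot)$ is lower semicontinuous on $\mathcal X$, that $(\omega,x)\mapsto f(\xi(\omega),x)$ is measurable for the completion of $\mathcal F\otimes\mathscr B$ ($\mathscr B$ the Borel $\sigma$-algebra of $\mathcal X$), that the set of $x\in\mathcal X$ with finite objective $F(x)=f_0(x)+\mathbb E[f(\xi,x)]<+\infty$ is non-empty, and that all quantities of interest are measurable. The rows of each matrix value of $W_\xi$ are assumed linearly independent, so that each cone $\{a:a^TW_\xi\ge0\}$ is pointed and is minimally generated by its unique finite set of non-equivalent extreme rays (two rays are equivalent if they are positive multiples of each other). $\mathbb P^N$ is the joint law of $N$ IID samples of $\xi$. The SAA problem replaces $\mathbb E[f(\xi,x)]$ by $\frac1N\sum_{i=1}^N f(\xi_i,x)$; its feasible region is $\bigcap_{i=1}^N\{x\in\mathcal X:f(\xi_i,x)<+\infty\}$. The violation probability is $V(x)=\mathbb P(\xi\in\Xi:f(\xi,x)=+\infty)$ for $x\in\mathcal X$. $\log$ is the natural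 logarithm. *)

theory Defs
  imports "HOL-Probability.Probability"
begin

definition second_stage_value ::
  "('p \<Rightarrow> real^'m \<Rightarrow> ereal) \<Rightarrow> ('p \<Rightarrow> real^'m^'k) \<Rightarrow> ('p \<Rightarrow> real^'n^'k) \<Rightarrow> ('p \<Rightarrow> real^'k)
    \<Rightarrow> 'p \<Rightarrow> real^'n \<Rightarrow> ereal"
where
  "second_stage_value g W T h \<xi> x =
    (INF y\<in>{y. W \<xi> *v y + T \<xi> *v x = h \<xi> \<and> (\<forall>j. 0 \<le> y $ j)}. g \<xi> y)"

text \<open>Each of the two terms below is the integral of a truncation: \<open>e2ennreal\<close> maps negative
  numbers to \<open>0\<close>. If both are infinite the value is \<open>\<infinity>\<close>, since \<open>\<infinity> - \<infinity> = \<infinity>\<close>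
  in \<^typ>\<open>ereal\<close>.\<close>

definition ext_expectation :: "'w measure \<Rightarrow> ('w \<Rightarrow> ereal) \<Rightarrow> ereal" where
  "ext_expectation M Y =
    enn2ereal (\<integral>\<^sup>+\<omega>. e2ennreal (Y \<omega>) \<partial>M) - enn2ereal (\<integral>\<^sup>+\<omega>. e2ennreal (- Y \<omega>) \<partial>M)"

definition lsc_on :: "'a::topological_space set \<Rightarrow> ('a \<Rightarrow> ereal) \<Rightarrow> bool" where
  "lsc_on X \<phi> \<longleftrightarrow> (\<forall>x\<in>X. \<phi> x \<le> Liminf (at x within X) \<phi>)"

definition violation_prob ::
  "'w measure \<Rightarrow> ('w \<Rightarrow> 'p) \<Rightarrow> ('p \<Rightarrow> 'x \<Rightarrow> ereal) \<Rightarrow> 'x \<Rightarrow> real"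
where
  "violation_prob M \<xi> f x = measure M {\<omega> \<in> space M. f (\<xi> \<omega>) x = \<infinity>}"

definition saa_feasible ::
  "'x set \<Rightarrow> ('p \<Rightarrow> 'x \<Rightarrow> ereal) \<Rightarrow> nat \<Rightarrow> (nat \<Rightarrow> 'p) \<Rightarrow> 'x set"
where
  "saa_feasible X f N s = {x \<in> X. \<forall>i<N. f (s i) x < \<infinity>}"

text \<open>\<^const>\<open>rows\<close> is a set and forgets repeated rows, hence the injectivity condition.\<close>

definition rows_lin_indep :: "real^'m^'k \<Rightarrow> bool" where
  "rows_lin_indep A \<longleftrightarrow> inj (\<lambda>i. row i A) \<and> independent (rows A)"

definition dual_cone :: "real^'m^'k \<Rightarrow> (real^'k) set" where
  "dual_cone A = {a. \<forall>j. 0 \<le> (a v* A) $ j}"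

definition extreme_ray_of :: "'a::real_vector \<Rightarrow> 'a set \<Rightarrow> bool" where
  "extreme_ray_of a C \<longleftrightarrow> a \<noteq> 0 \<and> (conic hull {a}) face_of C"

definition ray_equiv :: "('a::real_vector \<times> 'a) set" where
  "ray_equiv = {(a, b). \<exists>t>0. b = t *\<^sub>R a}"

definition num_extreme_rays :: "'a::real_vector set \<Rightarrow> nat" where
  "num_extreme_rays C = card ({a. extreme_ray_of a C} // ray_equiv)"

text \<open>Upper bound for the VC dimension of the sets cut out in an \<open>n\<close>-dimensional space by at most
  \<open>K\<close> affine inequalities. If all the cones are \<open>{0}\<close>, then \<open>K = 0\<close> and the value is \<open>0\<close>, the limit of
  \<open>K log K\<close> as \<open>K\<close> tends to \<open>0\<close>.\<close>

definition vc_bound :: "nat \<Rightarrow> nat \<Rightarrow> real" where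
  "vc_bound K n =
    exp 1 / ((exp 1 - 1) * ln 2) * real K * (real n + 1) * ln (exp 1 / ln 2 * real K)"

end

theory Submission
  imports Defs
begin

text \<open>By Farkas' lemma, \<open>x\<close> is infeasible for a scenario iff \<open>a \<bullet> (h - T x) < 0\<close> for one of at most
  \<open>J\<close> extreme rays \<open>a\<close> of the cone of that scenario. So the traces of the violation sets on \<open>2 N\<close>
  scenarios come from the sign patterns of \<open>2 N J\<close> affine functions on an \<open>n\<close>-dimensional space.
  Such patterns shatter at most \<open>n\<close> functions, and the shattering form of the Sauer lemma bounds
  their number by \<open>\<alpha>\<^sup>-\<^sup>n (1 + \<alpha>)\<^bsup>2 N J\<^esup>\<close> for every \<open>\<alpha> \<in> (0, 1]\<close>.

  Symmetrisation with a second sample, weighted by \<open>2\<close> to the number of its violations, shows that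
  the probability of a consistent output with violation above \<open>\<epsilon>\<close> is at most this number times
  \<open>(1 + \<epsilon>)\<^sup>-\<^sup>N \<le> exp (- N \<epsilon> / 2)\<close>. The choice \<open>\<alpha> = \<epsilon> / (8 J)\<close> gives the claim, because
  \<open>(8 J / \<epsilon>)\<^sup>n\<close> is far below \<open>12 / \<epsilon>\<close> raised to the stated dimension bound.

  The maps \<open>W\<close>, \<open>T\<close>, \<open>h\<close> are measurable only after composition with \<open>\<xi>\<close>, so the estimate is made on
  the product of the underlying probability space and then carried over to the law of the samples.\<close>

section \<open>Shattering and the number of sign patterns of affine functions\<close>

definition shatters :: "'a set set \<Rightarrow> 'a set \<Rightarrow> bool" where
  "shatters \<F> S \<longleftrightarrow> (\<forall>T\<subseteq>S. \<exists>F\<in>\<F>. F \<inter> S = T)"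

text \<open>Pajor's form of the Sauer lemma. Removing a point \<open>x\<close> from all members
  leaves a trace family \<open>\<A>\<close> and a family \<open>\<B>\<close> recording the members
  that collapse in pairs. A set shattered by \<open>\<A>\<close> is shattered by
  \<open>\<F>\<close>. A set shattered by \<open>\<B>\<close> remains so after adding
  \<open>x\<close>. The two kinds differ in whether they contain \<open>x\<close>, so they can be
  counted separately.\<close>

lemma card_le_card_shattered:
  assumes "finite U" and "\<F> \<subseteq> Pow U"
  shows "card \<F> \<le> card {S. S \<subseteq> U \<and> shatters \<F> S}"
  using assms
proof (induction U arbitrary: \<F> rule: finite_induct)
  case empty
  then consider "\<F> = {}" | "\<F> = {{}}" by fastforce
  then show ?case
  proof cases
    case 2
    then have "{S::'a set. S \<subseteq> {} \<and> shatters \<F> S} = {{}}" by (auto simp: shatters_def)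
    with 2 show ?thesis by simp
  qed simp
next
  case (insert x U)
  define \<A> where "\<A> = (\<lambda>F. F - {x}) ` \<F>"
  define \<B> where "\<B> = {F\<in>\<F>. x \<notin> F \<and> insert x F \<in> \<F>}"
  have fin: "finite \<F>" using insert by (meson finite.insertI finite_Pow_iff finite_subset)
  have AU: "\<A> \<subseteq> Pow U" and BU: "\<B> \<subseteq> Pow U"
    using insert.prems by (auto simp: \<A>_def \<B>_def)
  define \<F>1 where "\<F>1 = {F\<in>\<F>. x \<in> F}"
  define \<F>0 where "\<F>0 = {F\<in>\<F>. x \<notin> F}"
  have "card \<F> = card \<F>0 + card \<F>1"
    using fin by (subst card_Un_disjoint[symmetric]) (auto simp: \<F>0_def \<F>1_def Un_def Collect_disj_eq[symmetric] conj_disj_distribL[symmetric])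
  also have "card \<F>1 = card ((\<lambda>F. F - {x}) ` \<F>1)"
    by (rule card_image[symmetric]) (auto simp: inj_on_def \<F>1_def)
  \<comment> \<open>Inclusion-exclusion: the union is the trace family, and the overlap consists of
    the members whose extension by \<open>x\<close> is also present.\<close>
  also have "card \<F>0 + card ((\<lambda>F. F - {x}) ` \<F>1)
      = card (\<F>0 \<union> (\<lambda>F. F - {x}) ` \<F>1) + card (\<F>0 \<inter> (\<lambda>F. F - {x}) ` \<F>1)"
    using fin by (intro card_Un_Int) (auto simp: \<F>0_def \<F>1_def)
  also have "\<F>0 \<union> (\<lambda>F. F - {x}) ` \<F>1 = \<A>"
  proof -
    have "(\<lambda>F. F - {x}) ` \<F>0 = \<F>0" unfolding \<F>0_def by (rule image_cong[THEN trans, of _ _ _ id]) auto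
    moreover have "\<F> = \<F>0 \<union> \<F>1" by (auto simp: \<F>0_def \<F>1_def)
    ultimately show ?thesis unfolding \<A>_def by (metis image_Un)
  qed
  also have "\<F>0 \<inter> (\<lambda>F. F - {x}) ` \<F>1 = \<B>"
  proof (intro set_eqI iffI)
    fix F assume "F \<in> \<F>0 \<inter> (\<lambda>F. F - {x}) ` \<F>1"
    then show "F \<in> \<B>" by (auto simp: \<B>_def \<F>0_def \<F>1_def insert_absorb)
  next
    fix F assume F: "F \<in> \<B>"
    then have "F = insert x F - {x}" "insert x F \<in> \<F>1" by (auto simp: \<B>_def \<F>1_def)
    with F show "F \<in> \<F>0 \<inter> (\<lambda>F. F - {x}) ` \<F>1" by (auto simp: \<B>_def \<F>0_def)
  qed
  finally have split: "card \<F> = card \<A> + card \<B>" .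
  let ?SA = "{S. S \<subseteq> U \<and> shatters \<A> S}" and ?SB = "{S. S \<subseteq> U \<and> shatters \<B> S}"
  have finS: "finite ?SA" "finite ?SB" using insert.hyps(1) by (auto intro: finite_subset[of _ "Pow U"])
  have sA: "shatters \<F> S" if S: "S \<subseteq> U" "shatters \<A> S" for S
    unfolding shatters_def
  proof (intro allI impI)
    fix T assume "T \<subseteq> S"
    then obtain F where "F \<in> \<F>" "(F - {x}) \<inter> S = T" using S unfolding shatters_def \<A>_def by blast
    then show "\<exists>F\<in>\<F>. F \<inter> S = T" using S(1) insert.hyps(2) by (intro bexI[of _ F]) auto
  qed
  have sB: "shatters \<F> (insert x S)" if S: "S \<subseteq> U" "shatters \<B> S" for S
    unfolding shatters_def
  proof (intro allI impI)
    fix T assume T: "T \<subseteq> insert x S"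
    then have "T - {x} \<subseteq> S" by auto
    then obtain F where "F \<in> \<B>" and FS: "F \<inter> S = T - {x}"
      using S(2) unfolding shatters_def by meson
    then have F: "F \<in> \<F>" "x \<notin> F" "insert x F \<in> \<F>" by (auto simp: \<B>_def)
    show "\<exists>F\<in>\<F>. F \<inter> insert x S = T"
    proof (cases "x \<in> T")
      case True
      then show ?thesis using F FS T insert.hyps(2) S(1) by (intro bexI[of _ "insert x F"]) auto
    next
      case False
      then show ?thesis using F FS T by (intro bexI[of _ F]) auto
    qed
  qed
  have "card \<A> + card \<B> \<le> card ?SA + card ?SB"
    using insert.IH[OF AU] insert.IH[OF BU] by simp
  also have "card ?SB = card (insert x ` ?SB)"
    using insert.hyps(2) by (intro card_image[symmetric]) (auto simp: inj_on_def)
  also have "card ?SA + card (insert x ` ?SB) = card (?SA \<union> insert x ` ?SB)"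
    using finS insert.hyps(2) by (intro card_Un_disjoint[symmetric]) auto
  also have "\<dots> \<le> card {S. S \<subseteq> insert x U \<and> shatters \<F> S}"
    using insert.hyps(1) sA sB by (intro card_mono) (auto intro: finite_subset[of _ "Pow (insert x U)"])
  finally show ?case using split by simp
qed

text \<open>Each shattered set \<open>S\<close> is counted with weight \<open>\<alpha> ^ card S \<ge> \<alpha> ^ n\<close>.\<close>

lemma card_le_of_shattered_card_le:
  fixes \<alpha> :: real
  assumes "finite U" and "\<F> \<subseteq> Pow U" and "0 < \<alpha>" "\<alpha> \<le> 1"
    and "\<And>S. S \<subseteq> U \<Longrightarrow> shatters \<F> S \<Longrightarrow> card S \<le> n"
  shows "real (card \<F>) \<le> (1 / \<alpha>) ^ n * (1 + \<alpha>) ^ card U"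
proof -
  let ?S = "{S. S \<subseteq> U \<and> shatters \<F> S}"
  have fin: "finite ?S" using assms(1) by (auto intro: finite_subset[of _ "Pow U"])
  have "real (card ?S) * \<alpha> ^ n = (\<Sum>S\<in>?S. \<alpha> ^ n)" by simp
  also have "\<dots> \<le> (\<Sum>S\<in>?S. \<alpha> ^ card S)"
    using assms by (intro sum_mono power_decreasing) auto
  also have "\<dots> \<le> (\<Sum>S\<in>Pow U. \<alpha> ^ card S)"
    using assms by (intro sum_mono2) auto
  \<comment> \<open>With a factor 1 for each point outside \<open>S\<close>, the sum becomes the
    expansion of a product over \<open>U\<close>.\<close>
  also have "\<dots> = (\<Sum>S\<in>Pow U. (\<Prod>x\<in>S. \<alpha>) * (\<Prod>x\<in>U - S. 1))" by simp
  also have "\<dots> = (\<Prod>x\<in>U. \<alpha> + 1)" using assms(1) by (rule prod_add[symmetric])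
  finally have "real (card ?S) * \<alpha> ^ n \<le> (1 + \<alpha>) ^ card U" by (simp add: add.commute)
  then have "real (card ?S) \<le> (1 / \<alpha>) ^ n * (1 + \<alpha>) ^ card U"
    using assms(3) by (simp add: field_simps power_one_over)
  with card_le_card_shattered[OF assms(1,2)] show ?thesis by linarith
qed

text \<open>\<open>dependent\<close> speaks of sets, whereas the gradients form a family that may
  repeat a vector. A repetition gives the coefficients 1 and -1 directly. Otherwise the dimension
  bound applies to the image.\<close>

lemma ex_nontrivial_vanishing_combination:
  fixes u :: "'b \<Rightarrow> 'a::euclidean_space"
  assumes "finite S" and "DIM('a) < card S"
  shows "\<exists>c. (\<Sum>j\<in>S. c j *\<^sub>R u j) = 0 \<and> (\<exists>j\<in>S. c j \<noteq> 0)"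
proof (cases "inj_on u S")
  case True
  then have "card (u ` S) > DIM('a)" using assms by (simp add: card_image)
  then have "dependent (u ` S)" using assms(1) by (intro dependent_biggerset) auto
  then obtain d where d: "(\<Sum>v\<in>u ` S. d v *\<^sub>R v) = 0" "\<exists>v\<in>u ` S. d v \<noteq> 0"
    using assms(1) by (auto simp: dependent_finite)
  then show ?thesis
    by (intro exI[of _ "d \<circ> u"]) (auto simp: sum.reindex[OF True])
next
  case False
  then obtain i j where ij: "i \<in> S" "j \<in> S" "u i = u j" "i \<noteq> j" by (auto simp: inj_on_def)
  have "(\<Sum>k\<in>S. ((if k = i then 1 else 0) - (if k = j then 1 else 0)) *\<^sub>R u k) = (0::'a)"
    using ij assms(1) by (simp add: scaleR_left_diff_distrib sum_subtractf if_distrib[of "\<lambda>c. c *\<^sub>R _"] cong: if_cong)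
  then show ?thesis using ij
    by (intro exI[of _ "\<lambda>k. (if k = i then 1 else 0) - (if k = j then 1 else 0)"]) auto
qed

text \<open>A linear dependence among more than \<open>n\<close> of the gradients makes a combination of the affine
  functions constant, and the two sign patterns read off its coefficients force that constant to be
  both negative and nonnegative (or positive and nonpositive).\<close>

lemma not_shatters_affine_signs:
  fixes u :: "'b \<Rightarrow> 'a::euclidean_space" and c :: "'b \<Rightarrow> real"
  assumes "finite S" and "S \<subseteq> U" and sh: "shatters ((\<lambda>x. {j\<in>U. u j \<bullet> x < c j}) ` X) S"
  shows "card S \<le> DIM('a)"
proof (rule ccontr)
  assume "\<not> card S \<le> DIM('a)"
  then obtain d where d: "(\<Sum>j\<in>S. d j *\<^sub>R u j) = 0" and nz: "\<exists>j\<in>S. d j \<noteq> 0"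
    using ex_nontrivial_vanishing_combination[OF assms(1), of u] by auto
  have const: "(\<Sum>j\<in>S. d j * (u j \<bullet> x - c j)) = - (\<Sum>j\<in>S. d j * c j)" for x
  proof -
    have "(\<Sum>j\<in>S. d j * (u j \<bullet> x)) = (\<Sum>j\<in>S. d j *\<^sub>R u j) \<bullet> x" by (simp add: inner_sum_left)
    then show ?thesis using d by (simp add: right_diff_distrib sum_subtractf)
  qed
  have pattern: "\<exists>x\<in>X. \<forall>j\<in>S. u j \<bullet> x < c j \<longleftrightarrow> P j" for P
  proof -
    have "{j\<in>S. P j} \<subseteq> S" by auto
    then obtain x where "x \<in> X" "{j\<in>U. u j \<bullet> x < c j} \<inter> S = {j\<in>S. P j}"
      using sh unfolding shatters_def by blast
    then show ?thesis using assms(2) by (intro bexI[of _ x]) auto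
  qed
  from pattern[of "\<lambda>j. d j > 0"] obtain x where x: "\<And>j. j \<in> S \<Longrightarrow> u j \<bullet> x < c j \<longleftrightarrow> d j > 0" by auto
  from pattern[of "\<lambda>j. d j < 0"] obtain y where y: "\<And>j. j \<in> S \<Longrightarrow> u j \<bullet> y < c j \<longleftrightarrow> d j < 0" by auto
  have x': "d j * (u j \<bullet> x - c j) \<le> 0" if "j \<in> S" for j
    using x[OF that] by (auto simp: mult_le_0_iff not_less)
  have y': "d j * (u j \<bullet> y - c j) \<ge> 0" if "j \<in> S" for j
    using y[OF that] by (auto simp: zero_le_mult_iff not_less)
  from nz obtain j where j: "j \<in> S" "d j \<noteq> 0" by auto
  \<comment> \<open>Both sums equal the same constant, so strictness at one index is a
    contradiction. Where \<open>d j\<close> is positive the term of \<open>x\<close> is negative,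
    and where it is negative the term of \<open>y\<close> is positive.\<close>
  have "(\<Sum>j\<in>S. d j * (u j \<bullet> x - c j)) < (\<Sum>j\<in>S. d j * (u j \<bullet> y - c j))"
  proof (rule sum_strict_mono_ex1[OF assms(1)])
    show "\<forall>j\<in>S. d j * (u j \<bullet> x - c j) \<le> d j * (u j \<bullet> y - c j)"
      using x' y' order_trans by blast
    show "\<exists>j\<in>S. d j * (u j \<bullet> x - c j) < d j * (u j \<bullet> y - c j)"
    proof (intro bexI[OF _ j(1)], cases "d j > 0")
      case True
      then have "d j * (u j \<bullet> x - c j) < 0" using x[OF j(1)] by (simp add: mult_less_0_iff)
      then show "d j * (u j \<bullet> x - c j) < d j * (u j \<bullet> y - c j)" using y'[OF j(1)] by simp
    next
      case False
      then have "d j * (u j \<bullet> y - c j) > 0" using y[OF j(1)] j by (simp add: zero_less_mult_iff)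
      then show "d j * (u j \<bullet> x - c j) < d j * (u j \<bullet> y - c j)" using x'[OF j(1)] by simp
    qed
  qed
  then show False by (simp add: const)
qed

lemma card_affine_signs_le:
  fixes u :: "'b \<Rightarrow> 'a::euclidean_space" and c :: "'b \<Rightarrow> real" and \<alpha> :: real
  assumes "finite U" and "0 < \<alpha>" "\<alpha> \<le> 1"
  shows "real (card ((\<lambda>x. {j\<in>U. u j \<bullet> x < c j}) ` X)) \<le> (1 / \<alpha>) ^ DIM('a) * (1 + \<alpha>) ^ card U"
  using assms
  by (intro card_le_of_shattered_card_le not_shatters_affine_signs[of _ U u c X])
    (auto intro: finite_subset)

section \<open>Second-stage feasibility through Farkas' lemma and extreme rays\<close>

lemma mem_dual_cone_iff: "a \<in> dual_cone A \<longleftrightarrow> (\<forall>j. 0 \<le> a \<bullet> column j A)"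
  by (simp add: dual_cone_def vector_matrix_mult_def column_def inner_vec_def mult.commute)

lemma polyhedron_dual_cone: "polyhedron (dual_cone A)"
proof -
  have "dual_cone A = \<Inter> (range (\<lambda>j. {a. column j A \<bullet> a \<ge> 0}))"
    by (auto simp: mem_dual_cone_iff inner_commute)
  then show ?thesis by (auto intro!: polyhedron_Inter polyhedron_halfspace_ge)
qed

lemma conic_dual_cone: "conic (dual_cone A)"
  by (auto simp: conic_def mem_dual_cone_iff)

text \<open>Necessity pairs \<open>a v* A\<close> with \<open>y\<close>, both nonnegative. For
  sufficiency, a point outside the closed cone spanned by the columns is separated from it by a
  hyperplane whose normal lies in the dual cone.\<close>

lemma farkas:
  fixes A :: "real^'m^'k"
  shows "(\<exists>y. A *v y = b \<and> (\<forall>j. 0 \<le> y $ j)) \<longleftrightarrow> (\<forall>a\<in>dual_cone A. 0 \<le> a \<bullet> b)"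
proof
  assume "\<exists>y. A *v y = b \<and> (\<forall>j. 0 \<le> y $ j)"
  then obtain y where y: "A *v y = b" "\<And>j. 0 \<le> y $ j" by auto
  have "0 \<le> a \<bullet> b" if "a \<in> dual_cone A" for a
  proof -
    have "a \<bullet> b = (a v* A) \<bullet> y" using y(1) by (simp add: dot_lmul_matrix)
    also have "\<dots> \<ge> 0" using that y(2) by (auto simp: inner_vec_def dual_cone_def intro!: sum_nonneg)
    finally show ?thesis .
  qed
  then show "\<forall>a\<in>dual_cone A. 0 \<le> a \<bullet> b" by blast
next
  assume dual: "\<forall>a\<in>dual_cone A. 0 \<le> a \<bullet> b"
  \<comment> \<open>\<open>K\<close> collects the solvable right-hand sides. \<open>H\<close> is a
    cone generated by a finite set, hence closed, and the inclusion of \<open>H\<close> in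
    \<open>K\<close> suffices.\<close>
  define K where "K = {A *v y | y. \<forall>j. 0 \<le> y $ j}"
  define H where "H = convex_cone hull (range (\<lambda>j. column j A))"
  have "convex_cone K"
    unfolding convex_cone_iff
  proof (intro conjI ballI allI impI)
    show "0 \<in> K" by (auto simp: K_def intro!: exI[of _ 0])
    fix x y assume "x \<in> K" "y \<in> K"
    then obtain x' y' where "x = A *v x'" "y = A *v y'" "\<forall>j. 0 \<le> x' $ j" "\<forall>j. 0 \<le> y' $ j"
      by (auto simp: K_def)
    then show "x + y \<in> K"
      by (auto simp: K_def matrix_vector_right_distrib intro!: exI[of _ "x' + y'"])
  next
    fix x and c :: real assume "x \<in> K" "0 \<le> c"
    then obtain x' where "x = A *v x'" "\<forall>j. 0 \<le> x' $ j"
      by (auto simp: K_def)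
    with \<open>0 \<le> c\<close> show "c *\<^sub>R x \<in> K"
      by (auto simp: K_def matrix_vector_mult_scaleR intro!: exI[of _ "c *\<^sub>R x'"])
  qed
  moreover have "column j A \<in> K" for j
  proof -
    have "\<forall>i. 0 \<le> (axis j 1 :: real^'m) $ i" by (simp add: axis_def)
    then show ?thesis unfolding K_def by (intro CollectI exI[of _ "axis j 1"]) (simp add: matrix_vector_mult_basis)
  qed
  ultimately have HK: "H \<subseteq> K" unfolding H_def by (intro hull_minimal) auto
  have "b \<in> H"
  proof (rule ccontr)
    assume "b \<notin> H"
    moreover have "closed H" by (simp add: H_def closed_convex_cone_hull)
    moreover have "convex H" by (simp add: H_def convex_convex_cone_hull)
    ultimately obtain a c where ac: "a \<bullet> b < c" "\<And>x. x \<in> H \<Longrightarrow> c < a \<bullet> x"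
      using separating_hyperplane_closed_point by metis
    have c: "c < 0" using ac(2)[of 0] by (simp add: H_def convex_cone_hull_contains_0)
    have "0 \<le> a \<bullet> column j A" for j
    proof (rule ccontr)
      assume neg: "\<not> 0 \<le> a \<bullet> column j A"
      \<comment> \<open>The multiple is chosen so that \<open>a\<close> takes exactly the value
        \<open>c\<close> on it, which contradicts the strict separation. It is nonnegative because
        both numbers are negative.\<close>
      define t where "t = c / (a \<bullet> column j A)"
      have "t *\<^sub>R column j A \<in> H"
        unfolding H_def using c neg
        by (intro convex_cone_hull_mul hull_inc) (auto simp: t_def divide_nonpos_neg)
      from ac(2)[OF this] neg show False by (simp add: t_def)
    qed
    then have "a \<in> dual_cone A" by (simp add: mem_dual_cone_iff)
    with dual ac(1) c show False by force
  qed
  with HK show "\<exists>y. A *v y = b \<and> (\<forall>j. 0 \<le> y $ j)" by (auto simp: K_def)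
qed

text \<open>Each equivalence class is a face without the origin, and a polyhedron has finitely many
  faces. Finiteness makes \<open>num_extreme_rays\<close> a true count, since \<open>card\<close> is
  0 on infinite sets.\<close>

lemma finite_extreme_rays:
  fixes C :: "'a::euclidean_space set"
  assumes "polyhedron C"
  shows "finite ({a. extreme_ray_of a C} // ray_equiv)"
proof (rule finite_subset)
  show "finite ((\<lambda>F. F - {0}) ` {F. F face_of C})"
    using finite_polyhedron_faces[OF assms] by simp
  have "ray_equiv `` {a} = conic hull {a} - {0}" if "a \<noteq> 0" for a :: 'a
    using that by (auto simp: ray_equiv_def conic_hull_explicit order_less_le)
  then show "{a. extreme_ray_of a C} // ray_equiv \<subseteq> (\<lambda>F. F - {0}) ` {F. F face_of C}"
    by (auto simp: quotient_def extreme_ray_of_def)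
qed

text \<open>The hyperplane \<open>w \<bullet> a = 1\<close> cuts the cone in a polytope whose extreme points represent
  pairwise inequivalent extreme rays.\<close>

lemma pointed_cone_generators:
  fixes C :: "'a::euclidean_space set"
  assumes poly: "polyhedron C" and cone: "conic C"
    and pos: "\<And>a. a \<in> C \<Longrightarrow> a \<noteq> 0 \<Longrightarrow> 0 < w \<bullet> a"
  shows "\<exists>R. finite R \<and> card R \<le> num_extreme_rays C \<and>
             (\<forall>b. (\<forall>a\<in>C. 0 \<le> a \<bullet> b) \<longleftrightarrow> (\<forall>a\<in>R. 0 \<le> a \<bullet> b))"
proof -
  define B where "B = C \<inter> {a. w \<bullet> a = 1}"
  have clC: "closed C" and cvC: "convex C"
    using poly by (auto simp: polyhedron_imp_closed polyhedron_imp_convex)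
  have scale: "t *\<^sub>R a \<in> C" if "a \<in> C" "0 \<le> t" for a t using cone that by (auto simp: conic_def)
  have normalise: "(1 / (w \<bullet> a)) *\<^sub>R a \<in> B" if "a \<in> C" "a \<noteq> 0" for a
    using pos[OF that] scale[OF that(1), of "1 / (w \<bullet> a)"] by (auto simp: B_def)
  have "closed B" unfolding B_def by (intro closed_Int clC closed_hyperplane)
  moreover have "bounded B"
  \<comment> \<open>On the unit vectors of \<open>C\<close> the functional \<open>w\<close> attains
    a positive minimum, whose reciprocal bounds \<open>B\<close>. Without unit vectors in
    \<open>C\<close> there is no minimum to take, but then \<open>B\<close> is empty.\<close>
  proof (cases "C \<inter> sphere 0 1 = {}")
    case True
    have "B = {}"
    proof (rule ccontr)
      assume "B \<noteq> {}"
      then obtain a where a: "a \<in> C" "w \<bullet> a = 1" by (auto simp: B_def)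
      then have "a \<noteq> 0" by auto
      then have "(1 / norm a) *\<^sub>R a \<in> C \<inter> sphere 0 1" using scale[OF a(1)] by auto
      with True show False by blast
    qed
    then show ?thesis by simp
  next
    case False
    have "compact (C \<inter> sphere 0 1)" using clC by (simp add: closed_Int_compact)
    moreover have "continuous_on (C \<inter> sphere 0 1) (\<lambda>a. w \<bullet> a)" by (intro continuous_intros)
    ultimately obtain a0 where a0: "a0 \<in> C \<inter> sphere 0 1"
      and min: "\<And>a. a \<in> C \<inter> sphere 0 1 \<Longrightarrow> w \<bullet> a0 \<le> w \<bullet> a"
      using continuous_attains_inf[OF _ False, of "\<lambda>a. w \<bullet> a"] by blast
    then have m: "0 < w \<bullet> a0" by (intro pos) auto
    have "norm a \<le> 1 / (w \<bullet> a0)" if "a \<in> B" for a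
    proof -
      have a: "a \<in> C" "w \<bullet> a = 1" "a \<noteq> 0" using that by (auto simp: B_def)
      then have "(1 / norm a) *\<^sub>R a \<in> C \<inter> sphere 0 1" using scale[OF a(1)] by auto
      from min[OF this] a m show ?thesis by (simp add: field_simps)
    qed
    then show ?thesis by (auto simp: bounded_iff)
  qed
  ultimately have "compact B" by (simp add: compact_eq_bounded_closed)
  moreover have "convex B" unfolding B_def by (intro convex_Int cvC convex_hyperplane)
  ultimately have hull: "B = convex hull {e. e extreme_point_of B}" by (rule Krein_Milman_Minkowski)
  define R where "R = {e. e extreme_point_of B}"
  have RB: "R \<subseteq> B" by (auto simp: R_def extreme_point_of_def)
  \<comment> \<open>A segment of \<open>C\<close> meeting the ray of \<open>e\<close> is rescaled,
    endpoint by endpoint, to a segment of \<open>B\<close> through \<open>e\<close>. Extremality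
    makes both rescaled endpoints equal to \<open>e\<close>. An endpoint 0 cannot be rescaled and is
    treated apart.\<close>
  have ray: "extreme_ray_of e C" if e: "e \<in> R" for e
    unfolding extreme_ray_of_def face_of_def
  proof (intro conjI ballI impI)
    have eC: "e \<in> C" "w \<bullet> e = 1" using RB e by (auto simp: B_def)
    then show "e \<noteq> 0" by auto
    show "conic hull {e} \<subseteq> C" using cone eC by (intro hull_minimal) auto
    show "convex (conic hull {e})" by (simp add: convex_conic_hull)
    fix a b x assume ab: "a \<in> C" "b \<in> C" and x: "x \<in> conic hull {e}" "x \<in> open_segment a b"
    then obtain u t where u: "0 < u" "u < 1" "x = (1 - u) *\<^sub>R a + u *\<^sub>R b" "a \<noteq> b"
      and t: "x = t *\<^sub>R e" "0 \<le> t" by (auto simp: in_segment conic_hull_explicit)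
    have x_eq: "t *\<^sub>R e = (1 - u) *\<^sub>R a + u *\<^sub>R b" using u t by simp
    have hullI: "s *\<^sub>R e \<in> conic hull {e}" if "0 \<le> s" for s
      using that by (auto simp: conic_hull_explicit)
    have nonneg: "0 \<le> w \<bullet> a" "0 \<le> w \<bullet> b" using pos ab by (metis inner_zero_right less_eq_real_def)+
    have wt: "t = (1 - u) * (w \<bullet> a) + u * (w \<bullet> b)"
      using arg_cong[OF x_eq, of "\<lambda>v. w \<bullet> v"] eC by (simp add: inner_add_right)
    consider "a = 0" | "b = 0" | "a \<noteq> 0" "b \<noteq> 0" by blast
    then have "a \<in> conic hull {e} \<and> b \<in> conic hull {e}"
    proof cases
      case 1
      then have "b = (1 / u) *\<^sub>R (t *\<^sub>R e)" using x_eq u by simp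
      then have "b = (t / u) *\<^sub>R e" by simp
      moreover have "a = 0 *\<^sub>R e" using 1 by simp
      ultimately show ?thesis using hullI[of 0] hullI[of "t / u"] u t by simp
    next
      case 2
      then have "a = (1 / (1 - u)) *\<^sub>R (t *\<^sub>R e)" using x_eq u by simp
      then have "a = (t / (1 - u)) *\<^sub>R e" by simp
      moreover have "b = 0 *\<^sub>R e" using 2 by simp
      ultimately show ?thesis using hullI[of 0] hullI[of "t / (1 - u)"] u t by simp
    next
      case 3
      define a' where "a' = (1 / (w \<bullet> a)) *\<^sub>R a"
      define b' where "b' = (1 / (w \<bullet> b)) *\<^sub>R b"
      have wp: "0 < w \<bullet> a" "0 < w \<bullet> b" using pos ab 3 by auto
      have B': "a' \<in> B" "b' \<in> B" using normalise ab 3 by (auto simp: a'_def b'_def)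
      have tp: "0 < t" using wp u wt by (simp add: add_pos_pos)
      \<comment> \<open>Rescaling the endpoints by their \<open>w\<close>-values changes the weights
        \<open>1 - u\<close> and \<open>u\<close> into \<open>1 - v\<close> and \<open>v\<close>. By
        \<open>wt\<close> they still sum to 1.\<close>
      define v where "v = u * (w \<bullet> b) / t"
      have v: "0 < v" "v < 1" using wp u tp wt by (auto simp: v_def)
      have v1: "1 - v = (1 - u) * (w \<bullet> a) / t" using wt tp by (simp add: v_def field_simps)
      have "e = (1 / t) *\<^sub>R (t *\<^sub>R e)" using tp by simp
      also have "\<dots> = (1 - v) *\<^sub>R a' + v *\<^sub>R b'"
        unfolding x_eq v1 using wp tp by (simp add: a'_def b'_def v_def scaleR_add_right)
      finally have ev: "e = (1 - v) *\<^sub>R a' + v *\<^sub>R b'" .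
      have "a' = b'"
      proof (rule ccontr)
        assume "a' \<noteq> b'"
        then have "e \<in> open_segment a' b'" using ev v by (auto simp: in_segment)
        with e B' show False by (auto simp: R_def extreme_point_of_def)
      qed
      then have e': "a' = e" "b' = e" using ev by (auto simp: algebra_simps)
      have "a = (w \<bullet> a) *\<^sub>R a'" "b = (w \<bullet> b) *\<^sub>R b'" using wp by (auto simp: a'_def b'_def)
      then have "a = (w \<bullet> a) *\<^sub>R e" "b = (w \<bullet> b) *\<^sub>R e" by (simp_all only: e')
      then show ?thesis using hullI nonneg by metis
    qed
    then show "a \<in> conic hull {e}" "b \<in> conic hull {e}" by auto
  qed
  let ?cls = "\<lambda>e. ray_equiv `` {e}"
  \<comment> \<open>Equivalent points of the hyperplane coincide, because \<open>w\<close> fixes the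
    scaling factor to 1.\<close>
  have inj: "inj_on ?cls R"
  proof (rule inj_onI)
    fix e e' assume ee: "e \<in> R" "e' \<in> R" "?cls e = ?cls e'"
    have "e' \<in> ?cls e'" by (auto simp: ray_equiv_def intro!: exI[of _ 1])
    with ee(3) obtain t where t: "e' = t *\<^sub>R e" by (auto simp: ray_equiv_def)
    moreover have "w \<bullet> e = 1" "w \<bullet> e' = 1" using ee RB by (auto simp: B_def)
    ultimately show "e = e'" by auto
  qed
  have sub: "?cls ` R \<subseteq> {a. extreme_ray_of a C} // ray_equiv"
    using ray by (auto intro: quotientI)
  have fin: "finite (?cls ` R)" by (rule finite_subset[OF sub finite_extreme_rays[OF poly]])
  have "finite R" using fin inj by (rule finite_imageD)
  moreover have "card R \<le> num_extreme_rays C"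
    unfolding num_extreme_rays_def card_image[OF inj, symmetric]
    by (rule card_mono[OF finite_extreme_rays[OF poly] sub])
  moreover have "(\<forall>a\<in>C. 0 \<le> a \<bullet> b) \<longleftrightarrow> (\<forall>a\<in>R. 0 \<le> a \<bullet> b)" for b
  proof
    assume "\<forall>a\<in>C. 0 \<le> a \<bullet> b"
    then show "\<forall>a\<in>R. 0 \<le> a \<bullet> b" using RB by (auto simp: B_def)
  next
    assume R: "\<forall>a\<in>R. 0 \<le> a \<bullet> b"
    \<comment> \<open>The half-space given by \<open>b\<close> is convex, so it contains
      \<open>B\<close> once it contains \<open>R\<close>. Rescaling then extends the inequality to
      \<open>C\<close>.\<close>
    have "convex hull R \<subseteq> {a. b \<bullet> a \<ge> 0}"
      using R by (intro hull_minimal convex_halfspace_ge) (auto simp: inner_commute)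
    then have B: "0 \<le> a \<bullet> b" if "a \<in> B" for a using hull that by (auto simp: R_def inner_commute)
    show "\<forall>a\<in>C. 0 \<le> a \<bullet> b"
    proof
      fix a assume "a \<in> C"
      show "0 \<le> a \<bullet> b"
      proof (cases "a = 0")
        case False
        with B[OF normalise[OF \<open>a \<in> C\<close>]] pos[OF \<open>a \<in> C\<close>] show ?thesis by (simp add: zero_le_divide_iff)
      qed simp
    qed
  qed
  ultimately show ?thesis by blast
qed

text \<open>This is the source of pointedness. Injectivity of the row map lets the entries of
  \<open>a\<close> serve as coefficients on the set \<open>rows A\<close>.\<close>

lemma vector_matrix_mult_eq_0_imp:
  assumes "rows_lin_indep A" and "a v* A = 0"
  shows "a = 0"
proof -
  have inj: "inj (\<lambda>i. row i A)" and ind: "independent (rows A)"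
    using assms(1) by (auto simp: rows_lin_indep_def)
  define c where "c = (\<lambda>v. a $ (inv (\<lambda>i. row i A) v))"
  have rows: "rows A = range (\<lambda>i. row i A)" by (auto simp: rows_def)
  have "(\<Sum>v\<in>rows A. c v *\<^sub>R v) = (\<Sum>i\<in>UNIV. a $ i *\<^sub>R row i A)"
    unfolding rows by (subst sum.reindex[OF inj]) (simp add: c_def inv_f_f[OF inj])
  also have "\<dots> = a v* A"
    by (simp add: vec_eq_iff vector_matrix_mult_def row_def mult.commute)
  finally have "(\<Sum>v\<in>rows A. c v *\<^sub>R v) = 0" using assms(2) by simp
  then have "c (row i A) = 0" for i
    using independentD[OF ind, of "rows A" c "row i A"] by (auto simp: rows)
  then show ?thesis by (simp add: c_def inv_f_f[OF inj] vec_eq_iff)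
qed

text \<open>The sum of the columns, \<open>A *v 1\<close>, is a functional positive on the nonzero
  part of the dual cone: its value at \<open>a\<close> is the sum of the nonnegative entries of
  \<open>a v* A\<close>, which do not all vanish.\<close>

lemma feasible_iff_extreme_rays:
  fixes A :: "real^'m^'k"
  assumes "rows_lin_indep A"
  shows "\<exists>R. finite R \<and> card R \<le> num_extreme_rays (dual_cone A) \<and>
             (\<forall>b. (\<exists>y. A *v y = b \<and> (\<forall>j. 0 \<le> y $ j)) \<longleftrightarrow> (\<forall>a\<in>R. 0 \<le> a \<bullet> b))"
  unfolding farkas
proof (rule pointed_cone_generators[OF polyhedron_dual_cone conic_dual_cone, of _ "A *v 1"])
  fix a assume a: "a \<in> dual_cone A" "a \<noteq> 0"
  have eq: "(A *v 1) \<bullet> a = (\<Sum>j\<in>UNIV. (a v* A) $ j)"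
  proof -
    have "(A *v 1) \<bullet> a = (a v* A) \<bullet> 1" by (simp only: inner_commute[of "A *v 1"] dot_lmul_matrix)
    then show ?thesis by (simp add: inner_vec_def)
  qed
  have nn: "0 \<le> (a v* A) $ j" for j using a by (simp add: dual_cone_def)
  have "a v* A \<noteq> 0" using vector_matrix_mult_eq_0_imp[OF assms] a by blast
  then obtain j where "(a v* A) $ j \<noteq> 0" by (auto simp: vec_eq_iff)
  then have "0 < (\<Sum>j\<in>UNIV. (a v* A) $ j)"
    using nn by (intro sum_pos2[of _ j]) (auto simp: order_less_le)
  then show "0 < (A *v 1) \<bullet> a" by (simp add: eq)
qed

section \<open>Symmetrisation with a second sample\<close>

text \<open>Indices below \<open>N\<close> belong to the sample and \<open>N + i\<close> is the
  ghost partner of \<open>i\<close>. The set \<sigma> lists the pairs to be exchanged.\<close>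

definition swap_with_ghost :: "nat \<Rightarrow> nat set \<Rightarrow> nat \<Rightarrow> nat" where
  "swap_with_ghost N \<sigma> k =
    (if k < N then (if k \<in> \<sigma> then N + k else k) else (if k - N \<in> \<sigma> then k - N else k))"

lemma swap_with_ghost_swap_with_ghost:
  assumes "\<sigma> \<subseteq> {..<N}"
  shows "swap_with_ghost N \<sigma> (swap_with_ghost N \<sigma> k) = k"
  using assms by (auto simp: swap_with_ghost_def)

lemma swap_with_ghost_less:
  assumes "\<sigma> \<subseteq> {..<N}" "k < 2 * N"
  shows "swap_with_ghost N \<sigma> k < 2 * N"
  using assms by (auto simp: swap_with_ghost_def)

text \<open>If \<open>\<sigma>\<close> is chosen by fair coin flips, then each of the \<open>N\<close> pairs \<open>(i, N + i)\<close> contributes a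
  factor of mean at most \<open>1\<close>: it is \<open>1\<close> unless exactly one of the two points lies in \<open>t\<close>, and then
  it is \<open>0\<close> or \<open>2\<close>.\<close>

lemma sum_swaps_le:
  fixes N :: nat and t :: "nat set"
  shows "(\<Sum>\<sigma>\<in>Pow {..<N}. of_bool (\<forall>i<N. swap_with_ghost N \<sigma> i \<notin> t) *
            (\<Prod>i<N. 1 + of_bool (swap_with_ghost N \<sigma> (N + i) \<in> t))) \<le> (2 ^ N :: ennreal)"
proof -
  \<comment> \<open>\<open>a i\<close> is the factor of pair \<open>i\<close> when it is exchanged,
    and \<open>b i\<close> its factor when it is not.\<close>
  define a where "a i = of_bool (N + i \<notin> t) * (1 + of_bool (i \<in> t) :: ennreal)" for i
  define b where "b i = of_bool (i \<notin> t) * (1 + of_bool (N + i \<in> t) :: ennreal)" for i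
  have "of_bool (\<forall>i<N. swap_with_ghost N \<sigma> i \<notin> t) *
            (\<Prod>i<N. 1 + of_bool (swap_with_ghost N \<sigma> (N + i) \<in> t)) = prod a \<sigma> * prod b ({..<N} - \<sigma>)"
    (is "?l * ?r = _") if "\<sigma> \<in> Pow {..<N}" for \<sigma>
  proof -
    have "?l = (\<Prod>i<N. of_bool (swap_with_ghost N \<sigma> i \<notin> t))"
      by (cases "\<forall>i<N. swap_with_ghost N \<sigma> i \<notin> t") (auto intro!: prod_zero[symmetric])
    then have "?l * ?r = (\<Prod>i<N. of_bool (swap_with_ghost N \<sigma> i \<notin> t) *
                       (1 + of_bool (swap_with_ghost N \<sigma> (N + i) \<in> t)))"
      by (simp add: prod.distrib)
    also have "\<dots> = (\<Prod>i<N. if i \<in> \<sigma> then a i else b i)"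
      by (intro prod.cong) (auto simp: a_def b_def swap_with_ghost_def)
    also have "\<dots> = prod a \<sigma> * prod b ({..<N} - \<sigma>)"
    proof -
      have "{..<N} \<inter> {i. i \<in> \<sigma>} = \<sigma>" "{..<N} \<inter> - {i. i \<in> \<sigma>} = {..<N} - \<sigma>"
        using that by auto
      then show ?thesis by (subst prod.If_cases) auto
    qed
    finally show ?thesis .
  qed
  then have "(\<Sum>\<sigma>\<in>Pow {..<N}. of_bool (\<forall>i<N. swap_with_ghost N \<sigma> i \<notin> t) *
            (\<Prod>i<N. 1 + of_bool (swap_with_ghost N \<sigma> (N + i) \<in> t)))
        = (\<Sum>\<sigma>\<in>Pow {..<N}. prod a \<sigma> * prod b ({..<N} - \<sigma>))"
    by (intro sum.cong) auto
  also have "\<dots> = (\<Prod>i<N. a i + b i)" by (rule prod_add[symmetric]) simp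
  also have "\<dots> \<le> 2 ^ N"
  proof -
    have "a i + b i \<le> 2" for i by (auto simp: a_def b_def one_add_one)
    then have "(\<Prod>i<n. a i + b i) \<le> 2 ^ n" for n
      by (induction n) (auto simp: power_Suc2 simp del: power_Suc intro!: mult_mono)
    then show ?thesis .
  qed
  finally show ?thesis .
qed

text \<open>The event is weighted with \<open>2\<close> to the number of violations in a second, independent sample.
  Given the first sample, this weight has mean at least \<open>(1 + \<epsilon>) ^ N\<close>. Since the joint law of the
  \<open>2 * N\<close> points is invariant under swaps, its overall mean is at most the number of traces.\<close>

lemma (in prob_space) consistent_violation_le:
  fixes Y :: "(nat \<Rightarrow> 'a) \<Rightarrow> 'x" and C :: "('a \<times> 'x) set" and N :: nat and K :: real
  defines "P \<equiv> \<Pi>\<^sub>M i\<in>{..<N}. M"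
  assumes Y[measurable]: "Y \<in> P \<rightarrow>\<^sub>M S"
    and C: "C \<in> sets (M \<Otimes>\<^sub>M S)"
    and traces: "\<And>s. s \<in> {..<2*N} \<rightarrow> space M \<Longrightarrow>
        real (card ((\<lambda>x. {j\<in>{..<2*N}. (s j, x) \<in> C}) ` space S)) \<le> K"
    and "0 \<le> \<epsilon>" "0 \<le> K"
  shows "{s \<in> space P. (\<forall>i<N. (s i, Y s) \<notin> C) \<and> \<epsilon> < measure M {z\<in>space M. (z, Y s) \<in> C}} \<in> sets P" (is "?E \<in> _")
    and "(1 + \<epsilon>) ^ N * measure P {s \<in> space P. (\<forall>i<N. (s i, Y s) \<notin> C) \<and>
            \<epsilon> < measure M {z\<in>space M. (z, Y s) \<in> C}} \<le> K"
proof -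
  note M_prob = prob_space_axioms and M_space = emeasure_space_1 and M_measure = emeasure_eq_measure
  have [measurable]: "Measurable.pred (M \<Otimes>\<^sub>M S) (\<lambda>z. z \<in> C)" using C by simp
  have V[measurable]: "(\<lambda>x. measure M {z\<in>space M. (z, x) \<in> C}) \<in> borel_measurable S"
  proof -
    \<comment> \<open>\<open>measurable_emeasure_Pair\<close> fixes the first coordinate of a pair,
      so the two coordinates of \<open>C\<close> are flipped first.\<close>
    have "(\<lambda>x. emeasure M (Pair x -` ((\<lambda>(x,z). (z,x)) -` C \<inter> space (S \<Otimes>\<^sub>M M)))) \<in> borel_measurable S"
      by (rule measurable_emeasure_Pair) measurable
    also have "?this \<longleftrightarrow> (\<lambda>x. emeasure M {z\<in>space M. (z, x) \<in> C}) \<in> borel_measurable S"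
      by (intro measurable_cong arg_cong[where f="emeasure M"]) (auto simp: space_pair_measure)
    finally show ?thesis unfolding measure_def by measurable
  qed
  interpret product_prob_space "\<lambda>_. M" "{..<N}" by unfold_locales
  interpret PP: prob_space P unfolding P_def by (intro prob_space_PiM M_prob)
  have [measurable]: "(\<lambda>s. s i) \<in> P \<rightarrow>\<^sub>M M" if "i < N" for i
    unfolding P_def using that by (intro measurable_component_singleton) simp
  show E[measurable]: "?E \<in> sets P" by measurable
  let ?U = "{..<2*N}" and ?J = "{N..<2*N}"
  define Q where "Q = (\<Pi>\<^sub>M i\<in>?U. M)"
  interpret QQ: prob_space Q unfolding Q_def by (intro prob_space_PiM M_prob)
  have U: "?U = {..<N} \<union> ?J" by auto
  have [measurable]: "(\<lambda>s. s i) \<in> Q \<rightarrow>\<^sub>M M" if "i < 2*N" for i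
    unfolding Q_def using that by (intro measurable_component_singleton) simp
  have R[measurable]: "(\<lambda>s. restrict s {..<N}) \<in> Q \<rightarrow>\<^sub>M P"
    unfolding Q_def P_def by (rule measurable_restrict_subset) auto
  define w :: "(nat \<Rightarrow> 'a) \<Rightarrow> ennreal" where
    "w s = indicator ?E (restrict s {..<N}) * (\<Prod>j\<in>?J. 1 + of_bool ((s j, Y (restrict s {..<N})) \<in> C))" for s
  have w[measurable]: "w \<in> borel_measurable Q"
    unfolding w_def of_bool_def by measurable
  have lower: "ennreal ((1 + \<epsilon>) ^ N * measure P ?E) \<le> (\<integral>\<^sup>+s. w s \<partial>Q)"
  proof -
    \<comment> \<open>By Fubini the first sample, and with it the output, is frozen. The integral
      over the ghost points then splits into \<open>N\<close> equal factors.\<close>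
    have "(\<integral>\<^sup>+s. w s \<partial>Q) = (\<integral>\<^sup>+x. (\<integral>\<^sup>+y. w (merge {..<N} ?J (x, y)) \<partial>(\<Pi>\<^sub>M i\<in>?J. M)) \<partial>P)"
      unfolding Q_def P_def U
      by (rule product_nn_integral_fold) (use w in \<open>auto simp: Q_def U[symmetric]\<close>)
    also have "\<dots> \<ge> (\<integral>\<^sup>+x. ennreal ((1 + \<epsilon>) ^ N) * indicator ?E x \<partial>P)"
    proof (rule nn_integral_mono)
      fix x assume x: "x \<in> space P"
      show "ennreal ((1 + \<epsilon>) ^ N) * indicator ?E x \<le> (\<integral>\<^sup>+y. w (merge {..<N} ?J (x, y)) \<partial>(\<Pi>\<^sub>M i\<in>?J. M))"
      proof (cases "x \<in> ?E")
        case True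
        then have xE: "\<epsilon> < measure M {z\<in>space M. (z, Y x) \<in> C}" by simp
        have YS: "Y x \<in> space S" using x Y by (rule measurable_space[rotated])
        have [measurable]: "{z\<in>space M. (z, Y x) \<in> C} \<in> sets M" using YS by measurable
        have rs: "restrict (merge {..<N} ?J (x, y)) {..<N} = x" for y
          using x by (auto simp: P_def space_PiM PiE_def extensional_def fun_eq_iff restrict_def merge_def)
        have mj: "merge {..<N} ?J (x, y) j = y j" if "j \<in> ?J" for y j
          using that by (simp add: merge_def)
        have "(\<integral>\<^sup>+y. w (merge {..<N} ?J (x, y)) \<partial>(\<Pi>\<^sub>M i\<in>?J. M))
            = (\<integral>\<^sup>+y. (\<Prod>j\<in>?J. 1 + of_bool ((y j, Y x) \<in> C)) \<partial>(\<Pi>\<^sub>M i\<in>?J. M))"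
          using True by (intro nn_integral_cong) (simp add: w_def rs mj)
        also have "\<dots> = (\<Prod>j\<in>?J. \<integral>\<^sup>+z. 1 + of_bool ((z, Y x) \<in> C) \<partial>M)"
          using YS by (intro product_nn_integral_prod) (auto simp: of_bool_def)
        also have "(\<integral>\<^sup>+z. 1 + of_bool ((z, Y x) \<in> C) \<partial>M)
            = (\<integral>\<^sup>+z. 1 + indicator {z\<in>space M. (z, Y x) \<in> C} z \<partial>M)"
          by (intro nn_integral_cong) (auto simp: indicator_def)
        also have "\<dots> = 1 + emeasure M {z\<in>space M. (z, Y x) \<in> C}"
          by (subst nn_integral_add) (auto simp: M_space)
        also have "\<dots> = ennreal (1 + measure M {z\<in>space M. (z, Y x) \<in> C})"
          by (simp add: M_measure)
        finally have "(\<integral>\<^sup>+y. w (merge {..<N} ?J (x, y)) \<partial>(\<Pi>\<^sub>M i\<in>?J. M))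
            = ennreal ((1 + measure M {z\<in>space M. (z, Y x) \<in> C}) ^ N)"
          by (simp add: ennreal_power[symmetric])
        also have "\<dots> \<ge> ennreal ((1 + \<epsilon>) ^ N)"
          using xE \<open>0 \<le> \<epsilon>\<close> by (intro ennreal_leI power_mono) auto
        finally show ?thesis using True by simp
      qed simp
    qed
    also have "(\<integral>\<^sup>+x. ennreal ((1 + \<epsilon>) ^ N) * indicator ?E x \<partial>P) = ennreal ((1 + \<epsilon>) ^ N * measure P ?E)"
      using \<open>0 \<le> \<epsilon>\<close> by (subst nn_integral_cmult_indicator) (auto simp: PP.emeasure_eq_measure ennreal_mult')
    finally show ?thesis by (simp add: mult.commute)
  qed
  have swap: "(\<integral>\<^sup>+s. w s \<partial>Q) = (\<integral>\<^sup>+s. w (\<lambda>k\<in>?U. s (swap_with_ghost N \<sigma> k)) \<partial>Q)"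
    and swap_meas: "(\<lambda>s. w (\<lambda>k\<in>?U. s (swap_with_ghost N \<sigma> k))) \<in> borel_measurable Q"
    if "\<sigma> \<in> Pow {..<N}" for \<sigma>
  proof -
    have \<sigma>: "\<sigma> \<subseteq> {..<N}" using that by simp
    have "inj_on (swap_with_ghost N \<sigma>) ?U"
      by (rule inj_on_inverseI) (rule swap_with_ghost_swap_with_ghost[OF \<sigma>])
    moreover have maps: "swap_with_ghost N \<sigma> \<in> ?U \<rightarrow> ?U" using swap_with_ghost_less[OF \<sigma>] by auto
    ultimately have "distr Q Q (\<lambda>s. \<lambda>k\<in>?U. s (swap_with_ghost N \<sigma> k)) = Q"
      unfolding Q_def by (intro distr_PiM_reindex M_prob)
    moreover have [measurable]: "(\<lambda>s. \<lambda>k\<in>?U. s (swap_with_ghost N \<sigma> k)) \<in> Q \<rightarrow>\<^sub>M Q"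
      unfolding Q_def using maps by (intro measurable_restrict measurable_component_singleton) auto
    ultimately show "(\<integral>\<^sup>+s. w s \<partial>Q) = (\<integral>\<^sup>+s. w (\<lambda>k\<in>?U. s (swap_with_ghost N \<sigma> k)) \<partial>Q)"
      by (metis nn_integral_distr w)
    show "(\<lambda>s. w (\<lambda>k\<in>?U. s (swap_with_ghost N \<sigma> k))) \<in> borel_measurable Q" by measurable
  qed
  have pointwise: "(\<Sum>\<sigma>\<in>Pow {..<N}. w (\<lambda>k\<in>?U. s (swap_with_ghost N \<sigma> k))) \<le> ennreal K * 2 ^ N"
    if s: "s \<in> space Q" for s
  proof -
    define \<T> where "\<T> = (\<lambda>x. {j\<in>?U. (s j, x) \<in> C}) ` space S"
    have sM: "s \<in> ?U \<rightarrow> space M" using s by (auto simp: Q_def space_PiM)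
    have fin: "finite \<T>" by (rule finite_subset[of _ "Pow ?U"]) (auto simp: \<T>_def)
    define G :: "nat set \<Rightarrow> nat set \<Rightarrow> ennreal" where
      "G \<sigma> t = of_bool (\<forall>i<N. swap_with_ghost N \<sigma> i \<notin> t) *
        (\<Prod>i<N. 1 + of_bool (swap_with_ghost N \<sigma> (N + i) \<in> t))" for \<sigma> t
    \<comment> \<open>The output, and hence its trace \<open>t\<close>, changes with \<sigma>.
      Summing over all traces removes this dependence, so the sum over \<sigma> can be taken with
      \<open>t\<close> fixed.\<close>
    have "w (\<lambda>k\<in>?U. s (swap_with_ghost N \<sigma> k)) \<le> (\<Sum>t\<in>\<T>. G \<sigma> t)" if \<sigma>: "\<sigma> \<in> Pow {..<N}" for \<sigma>
    proof -
      have less: "k < 2 * N \<Longrightarrow> swap_with_ghost N \<sigma> k < 2 * N" for k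
        using swap_with_ghost_less \<sigma> by simp
      define s' where "s' = (\<lambda>k\<in>?U. s (swap_with_ghost N \<sigma> k))"
      define r where "r = restrict s' {..<N}"
      have "r \<in> space P"
        using sM less by (auto simp: r_def s'_def P_def space_PiM split: if_splits)
      then have YS: "Y r \<in> space S" using Y by (rule measurable_space[rotated])
      define t where "t = {j\<in>?U. (s j, Y r) \<in> C}"
      have t: "t \<in> \<T>" using YS by (auto simp: \<T>_def t_def)
      have "w s' \<le> G \<sigma> t"
      proof (cases "r \<in> ?E")
        case True
        then have "\<forall>i<N. (r i, Y r) \<notin> C" by simp
        then have "\<forall>i<N. swap_with_ghost N \<sigma> i \<notin> t" by (auto simp: t_def r_def s'_def)
        moreover have "w s' = (\<Prod>j\<in>?J. 1 + of_bool ((s' j, Y r) \<in> C))"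
          using True by (simp add: w_def r_def)
        moreover have "\<dots> = (\<Prod>i<N. 1 + of_bool (swap_with_ghost N \<sigma> (N + i) \<in> t))"
        proof -
          have "?J = (+) N ` {..<N}" by (simp add: lessThan_atLeast0 mult_2)
          then have "(\<Prod>j\<in>?J. 1 + of_bool ((s' j, Y r) \<in> C)) =
              (\<Prod>i<N. 1 + of_bool ((s' (N + i), Y r) \<in> C) :: ennreal)"
            by (simp only:) (subst prod.reindex, auto)
          also have "\<dots> = (\<Prod>i<N. 1 + of_bool (swap_with_ghost N \<sigma> (N + i) \<in> t))"
            using less by (intro prod.cong) (auto simp: t_def s'_def)
          finally show ?thesis .
        qed
        ultimately show ?thesis by (simp add: G_def)
      next
        case False
        then show ?thesis by (simp add: w_def r_def)
      qed
      also have "\<dots> \<le> (\<Sum>t\<in>\<T>. G \<sigma> t)" using fin t by (intro member_le_sum) auto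
      finally show ?thesis by (simp add: s'_def)
    qed
    then have "(\<Sum>\<sigma>\<in>Pow {..<N}. w (\<lambda>k\<in>?U. s (swap_with_ghost N \<sigma> k)))
        \<le> (\<Sum>\<sigma>\<in>Pow {..<N}. \<Sum>t\<in>\<T>. G \<sigma> t)"
      by (intro sum_mono) auto
    also have "\<dots> = (\<Sum>t\<in>\<T>. \<Sum>\<sigma>\<in>Pow {..<N}. G \<sigma> t)" by (rule sum.swap)
    also have "\<dots> \<le> (\<Sum>t\<in>\<T>. 2 ^ N)"
      unfolding G_def by (intro sum_mono sum_swaps_le)
    also have "\<dots> = of_nat (card \<T>) * 2 ^ N" by simp
    also have "\<dots> \<le> ennreal K * 2 ^ N"
      using traces[OF sM] by (intro mult_right_mono) (auto simp: \<T>_def ennreal_of_nat_eq_real_of_nat intro!: ennreal_leI)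
    finally show ?thesis .
  qed
  \<comment> \<open>Swap invariance turns the integral into an average over all \<sigma>, to which
    the pointwise bound applies.\<close>
  have "2 ^ N * (\<integral>\<^sup>+s. w s \<partial>Q) = (\<Sum>\<sigma>\<in>Pow {..<N}. \<integral>\<^sup>+s. w s \<partial>Q)"
    by (simp add: card_Pow)
  also have "\<dots> = (\<Sum>\<sigma>\<in>Pow {..<N}. \<integral>\<^sup>+s. w (\<lambda>k\<in>?U. s (swap_with_ghost N \<sigma> k)) \<partial>Q)"
    by (intro sum.cong refl swap)
  also have "\<dots> = (\<integral>\<^sup>+s. (\<Sum>\<sigma>\<in>Pow {..<N}. w (\<lambda>k\<in>?U. s (swap_with_ghost N \<sigma> k))) \<partial>Q)"
    by (intro nn_integral_sum[symmetric] swap_meas)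
  also have "\<dots> \<le> (\<integral>\<^sup>+s. ennreal K * 2 ^ N \<partial>Q)"
    by (intro nn_integral_mono pointwise)
  also have "\<dots> = 2 ^ N * ennreal K" by (simp add: QQ.emeasure_space_1 mult.commute)
  finally have "(\<integral>\<^sup>+s. w s \<partial>Q) \<le> ennreal K"
    by (subst (asm) ennreal_mult_le_mult_iff) (auto simp: power_eq_top_ennreal)
  with lower have "ennreal ((1 + \<epsilon>) ^ N * measure P ?E) \<le> ennreal K"
    by (rule order_trans)
  then show "(1 + \<epsilon>) ^ N * measure P ?E \<le> K" using \<open>0 \<le> K\<close> by (simp add: ennreal_le_iff)
qed

section \<open>Numerical estimates\<close>

text \<open>Since e is at most \<open>12 / \<epsilon>\<close>, the number \<open>J\<close> is at
  most \<open>12 / \<epsilon>\<close> to the power \<open>ln J\<close>, so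
  \<open>1 / \<alpha>\<close> is bounded by the power \<open>1 + ln J\<close>. The constants in
  \<open>vc_bound\<close> only enlarge \<open>n * (1 + ln J)\<close>. For \<open>J = 0\<close> both
  sides are 1.\<close>

lemma inverse_power_le_powr_vc_bound:
  fixes \<epsilon> \<alpha> :: real and J n :: nat
  assumes "0 < \<epsilon>" "\<epsilon> < 1"
  defines "\<alpha> \<equiv> if J = 0 then 1 else \<epsilon> / (8 * real J)"
  shows "(1 / \<alpha>) ^ n \<le> (12 / \<epsilon>) powr vc_bound J n"
proof (cases "J = 0")
  case True
  then show ?thesis using assms by (simp add: vc_bound_def)
next
  case False
  then have J: "1 \<le> real J" by simp
  have ln2: "0 < ln (2::real)" "ln (2::real) < 1" using ln_2_less_1 by auto
  have c1: "1 \<le> exp 1 / ((exp 1 - 1) * ln (2::real))"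
  proof -
    have e: "0 < exp 1 - (1::real)" by simp
    have "(exp 1 - 1) * ln 2 \<le> (exp 1 - 1) * (1::real)"
      using ln2 e by (intro mult_left_mono) auto
    also have "\<dots> \<le> exp 1" by simp
    finally have "(exp 1 - 1) * ln 2 \<le> (exp 1 :: real)" .
    moreover have "0 < (exp 1 - 1) * ln (2::real)" using e ln2 by (intro mult_pos_pos)
    ultimately show ?thesis by (simp only: le_divide_eq_1_pos)
  qed
  have c2: "1 + ln (real J) \<le> ln (exp 1 / ln 2 * real J)"
  proof -
    have "exp 1 * real J \<le> exp 1 / ln 2 * real J"
      using ln2 by (intro mult_right_mono) (auto simp: le_divide_eq)
    then have "ln (exp 1 * real J) \<le> ln (exp 1 / ln 2 * real J)" using J by simp
    then show ?thesis using J by (simp add: ln_mult)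
  qed
  have lnJ: "0 \<le> ln (real J)" using J by simp
  have "real n * (1 + ln (real J)) \<le> (real n + 1) * (1 + ln (real J))"
    using lnJ by (intro mult_right_mono) auto
  also have "\<dots> \<le> (1 * real J * (real n + 1)) * (1 + ln (real J))"
    using lnJ J by (intro mult_right_mono) auto
  also have "\<dots> \<le> (exp 1 / ((exp 1 - 1) * ln 2) * real J * (real n + 1)) * ln (exp 1 / ln 2 * real J)"
    using lnJ c1 c2 by (intro mult_mono mult_right_mono) auto
  finally have d: "real n * (1 + ln (real J)) \<le> vc_bound J n" by (simp add: vc_bound_def)
  have e12: "exp 1 \<le> 12 / \<epsilon>"
  proof -
    have "exp 1 \<le> (3::real)" by (rule exp_le)
    also have "\<dots> \<le> 12 / \<epsilon>" using assms by (simp add: le_divide_eq)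
    finally show ?thesis .
  qed
  have "1 / \<alpha> = 8 / \<epsilon> * real J" using False by (simp add: \<alpha>_def)
  also have "\<dots> \<le> 12 / \<epsilon> * real J" using assms by (intro mult_right_mono divide_right_mono) auto
  also have "\<dots> = 12 / \<epsilon> * exp 1 powr ln (real J)" using J by (simp add: powr_def)
  also have "\<dots> \<le> 12 / \<epsilon> * (12 / \<epsilon>) powr ln (real J)"
    using lnJ e12 assms by (intro mult_left_mono powr_mono2) auto
  also have "\<dots> = (12 / \<epsilon>) powr (1 + ln (real J))" using assms by (simp add: powr_add)
  finally have "(1 / \<alpha>) ^ n \<le> ((12 / \<epsilon>) powr (1 + ln (real J))) ^ n"
    using assms J by (intro power_mono) (auto simp: \<alpha>_def)
  also have "\<dots> = (12 / \<epsilon>) powr (real n * (1 + ln (real J)))"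
    using assms by (simp add: powr_powr powr_realpow[symmetric] mult.commute)
  also have "\<dots> \<le> (12 / \<epsilon>) powr vc_bound J n"
    using d assms by (intro powr_mono) (auto simp: le_divide_eq)
  finally show ?thesis .
qed

lemma exp_half_le_one_plus:
  fixes x :: real
  assumes "0 \<le> x" "x \<le> 1"
  shows "exp (x / 2) \<le> 1 + x"
proof -
  have "exp (x / 2) \<le> 1 + x / 2 + (x / 2)\<^sup>2" using assms by (intro exp_bound) simp_all
  also have "\<dots> \<le> 1 + x"
  proof -
    have "(x / 2)\<^sup>2 = x * x / 4" by (simp add: power2_eq_square)
    moreover have "x * x \<le> x" using assms by (intro mult_left_le)
    ultimately show ?thesis using assms(1) by linarith
  qed
  finally show ?thesis .
qed

section \<open>Measurability of vector-valued maps\<close>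

text \<open>The real-valued result is applied to each coordinate. The basis is finite, so the
  exceptional sets together remain null.\<close>

lemma completion_ex_borel_measurable_euclidean:
  fixes g :: "'a \<Rightarrow> 'b::euclidean_space"
  assumes "g \<in> borel_measurable (completion M)"
  shows "\<exists>g'\<in>borel_measurable M. AE x in M. g x = g' x"
proof -
  have ex: "\<forall>b. \<exists>g'. g' \<in> borel_measurable M \<and> (AE x in M. g x \<bullet> b = g' x)"
  proof
    fix b
    have "(\<lambda>x. g x \<bullet> b) \<in> borel_measurable (completion M)" using assms by simp
    from completion_ex_borel_measurable_real[OF this]
    show "\<exists>g'. g' \<in> borel_measurable M \<and> (AE x in M. g x \<bullet> b = g' x)" unfolding Bex_def .
  qed
  obtain G where G': "\<forall>b. G b \<in> borel_measurable M \<and> (AE x in M. g x \<bullet> b = G b x)"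
    using choice[OF ex] by (rule exE)
  have G: "G b \<in> borel_measurable M" "AE x in M. g x \<bullet> b = G b x" for b
    using G' by blast+
  have "AE x in M. \<forall>b\<in>Basis. g x \<bullet> b = G b x" by (intro AE_finite_allI finite_Basis G(2))
  then have "AE x in M. g x = (\<Sum>b\<in>Basis. G b x *\<^sub>R b)"
  proof eventually_elim
    case (elim x)
    have "g x = (\<Sum>b\<in>Basis. (g x \<bullet> b) *\<^sub>R b)" by (simp add: euclidean_representation)
    also have "\<dots> = (\<Sum>b\<in>Basis. G b x *\<^sub>R b)" using elim by (intro sum.cong) auto
    finally show ?case .
  qed
  moreover have "(\<lambda>x. \<Sum>b\<in>Basis. G b x *\<^sub>R b) \<in> borel_measurable M"
    by (intro borel_measurable_sum borel_measurable_scaleR borel_measurable_const G(1))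
  ultimately show ?thesis by (rule bexI)
qed

lemma borel_measurable_vec_nth:
  fixes v :: "'a \<Rightarrow> ('b::euclidean_space)^'n"
  assumes "v \<in> borel_measurable M"
  shows "(\<lambda>x. v x $ i) \<in> borel_measurable M"
  using assms by (rule borel_measurable_continuous_on[rotated]) (intro continuous_intros)

lemma borel_measurable_inner_matrix_vector_mult:
  fixes A :: "'a \<Rightarrow> real^'n^'k" and v :: "'a \<Rightarrow> real^'n"
  assumes "A \<in> borel_measurable M" "v \<in> borel_measurable M"
  shows "(\<lambda>x. a \<bullet> (A x *v v x)) \<in> borel_measurable M"
  unfolding inner_vec_def matrix_vector_mult_def vec_lambda_beta inner_real_def
  by (intro borel_measurable_sum borel_measurable_times borel_measurable_const
      borel_measurable_vec_nth assms)

section \<open>From the two-stage problem to the violation bound\<close>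

lemma second_stage_value_less_top_imp:
  assumes "second_stage_value g W T h z x < \<infinity>"
  shows "\<exists>y. W z *v y = h z - T z *v x \<and> (\<forall>j. 0 \<le> y $ j)"
proof (rule ccontr)
  assume "\<not> ?thesis"
  then have empty: "{y. W z *v y + T z *v x = h z \<and> (\<forall>j. 0 \<le> y $ j)} = {}"
    by (auto simp: eq_diff_eq)
  then have "second_stage_value g W T h z x = \<infinity>"
    unfolding second_stage_value_def empty by (simp add: top_ereal_def)
  with assms show False by simp
qed

lemma second_stage_value_less_top:
  assumes "W z *v y = h z - T z *v x" "\<forall>j. 0 \<le> y $ j" "g z y < \<infinity>"
  shows "second_stage_value g W T h z x < \<infinity>"
proof -
  have "second_stage_value g W T h z x \<le> g z y"
    unfolding second_stage_value_def using assms by (intro INF_lower) (auto simp: eq_diff_eq)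
  then show ?thesis using assms(3) by (rule order_le_less_trans)
qed

text \<open>A trace is the projection to \<open>I\<close> of a sign pattern on the pairs in
  \<open>Sigma I R\<close>, so there are no more traces than patterns.\<close>

lemma card_traces_le:
  fixes R :: "'i \<Rightarrow> 'b set" and u :: "'i \<Rightarrow> 'b \<Rightarrow> 'a::euclidean_space"
    and c :: "'i \<Rightarrow> 'b \<Rightarrow> real" and \<alpha> :: real
  assumes "finite I" "\<And>i. i \<in> I \<Longrightarrow> finite (R i)" "\<And>i. i \<in> I \<Longrightarrow> card (R i) \<le> J"
    and "0 < \<alpha>" "\<alpha> \<le> 1"
  shows "real (card ((\<lambda>x. {i\<in>I. \<exists>a\<in>R i. u i a \<bullet> x < c i a}) ` X))
    \<le> (1 / \<alpha>) ^ DIM('a) * (1 + \<alpha>) ^ (card I * J)"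
proof -
  define U where "U = Sigma I R"
  define S where "S = (\<lambda>x. {p\<in>U. u (fst p) (snd p) \<bullet> x < c (fst p) (snd p)}) ` X"
  have finU: "finite U" using assms by (auto simp: U_def)
  have "card U = (\<Sum>i\<in>I. card (R i))" using assms by (simp add: U_def card_SigmaI)
  also have "\<dots> \<le> card I * J" 
    using assms(3) sum_bounded_above[of I "\<lambda>i. card (R i)" J] by simp
  finally have cU: "card U \<le> card I * J" .
  have "(\<lambda>x. {i\<in>I. \<exists>a\<in>R i. u i a \<bullet> x < c i a}) ` X = (\<lambda>F. fst ` F) ` S"
    unfolding S_def image_image by (intro image_cong) (force simp: U_def)+
  moreover have "finite S"
    by (rule finite_subset[of _ "Pow U"]) (use finU in \<open>auto simp: S_def\<close>)
  ultimately have "card ((\<lambda>x. {i\<in>I. \<exists>a\<in>R i. u i a \<bullet> x < c i a}) ` X) \<le> card S"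
    by (simp add: card_image_le)
  also have "real (card S) \<le> (1 / \<alpha>) ^ DIM('a) * (1 + \<alpha>) ^ card U"
    unfolding S_def using finU assms(4,5)
    by (rule card_affine_signs_le)
  also have "\<dots> \<le> (1 / \<alpha>) ^ DIM('a) * (1 + \<alpha>) ^ (card I * J)"
    using assms(4) cU by (intro mult_left_mono power_increasing) auto
  finally show ?thesis by simp
qed

theorem corollary4p6:
  fixes M :: "'w measure"
    and \<xi> :: "'w \<Rightarrow> real^'r" and \<Xi> :: "(real^'r) set"
    and X :: "(real^'n) set" and f\<^sub>0 :: "real^'n \<Rightarrow> real"
    and g :: "real^'r \<Rightarrow> real^'m \<Rightarrow> ereal"
    and W :: "real^'r \<Rightarrow> real^'m^'k" and T :: "real^'r \<Rightarrow> real^'n^'k" and h :: "real^'r \<Rightarrow> real^'k"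
    and f :: "real^'r \<Rightarrow> real^'n \<Rightarrow> ereal" and F :: "real^'n \<Rightarrow> ereal"
    and V :: "real^'n \<Rightarrow> real"
    and p q J N :: nat and d\<^sub>V\<^sub>C \<epsilon> :: real
    and P\<^sub>N :: "(nat \<Rightarrow> real^'r) measure" and xstar :: "(nat \<Rightarrow> real^'r) \<Rightarrow> real^'n"
  assumes "prob_space M" and "complete_measure M"
    and "\<xi> \<in> borel_measurable M" and "\<And>\<omega>. \<omega> \<in> space M \<Longrightarrow> \<xi> \<omega> \<in> \<Xi>"
    and "X \<noteq> {}" and "closed X"
    and "AE \<omega> in M. (\<forall>y. \<bar>g (\<xi> \<omega>) y\<bar> \<noteq> \<infinity>) \<and>
                    convex_on UNIV (\<lambda>y. real_of_ereal (g (\<xi> \<omega>) y))"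
    and "(\<lambda>\<omega>. W (\<xi> \<omega>)) \<in> borel_measurable M"
    and "(\<lambda>\<omega>. T (\<xi> \<omega>)) \<in> borel_measurable M"
    and "(\<lambda>\<omega>. h (\<xi> \<omega>)) \<in> borel_measurable M"
    and "card (W ` \<Xi>) = p" and "0 < p"
    and "card (T ` \<Xi>) = q" and "0 < q"
    and "\<And>A. A \<in> W ` \<Xi> \<Longrightarrow> rows_lin_indep A"
    and "f = second_stage_value g W T h"
    and "\<And>z x. z \<in> \<Xi> \<Longrightarrow> x \<in> X \<Longrightarrow> f z x \<noteq> - \<infinity>"
    and "\<And>z. z \<in> \<Xi> \<Longrightarrow> lsc_on X (f z)"
    and "\<And>\<mu>. prob_space \<mu> \<Longrightarrow> sets \<mu> = sets (restrict_space borel X) \<Longrightarrow>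
           (\<lambda>(\<omega>, x). f (\<xi> \<omega>) x) \<in> borel_measurable (completion (M \<Otimes>\<^sub>M \<mu>))"
    and "F = (\<lambda>x. ereal (f\<^sub>0 x) + ext_expectation M (\<lambda>\<omega>. f (\<xi> \<omega>) x))"
    and "{x \<in> X. F x < \<infinity>} \<noteq> {}"
    and "V = violation_prob M \<xi> f"
    and "P\<^sub>N = completion (\<Pi>\<^sub>M i\<in>{..<N}. distr M borel \<xi>)"
    and "xstar \<in> borel_measurable P\<^sub>N"
    and "AE s in P\<^sub>N. xstar s \<in> saa_feasible X f N s"
    and "J = Max ((\<lambda>A. num_extreme_rays (dual_cone A)) ` (W ` \<Xi>))"
    and "d\<^sub>V\<^sub>C = vc_bound J CARD('n)"
    and "0 < \<epsilon>" and "\<epsilon> < 1"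
  shows "(\<forall>\<delta>. 0 < \<delta> \<longrightarrow> \<delta> < 1 \<longrightarrow>
            real N \<ge> 4 / \<epsilon> * (d\<^sub>V\<^sub>C * ln (12 / \<epsilon>) + ln (2 / \<delta>)) \<longrightarrow>
            measure P\<^sub>N {s \<in> space P\<^sub>N. V (xstar s) > \<epsilon>} \<le> \<delta>) \<and>
         measure P\<^sub>N {s \<in> space P\<^sub>N. V (xstar s) > \<epsilon>}
           \<le> 2 * exp (- (real N * \<epsilon> / 4)) * (12 / \<epsilon>) powr d\<^sub>V\<^sub>C"
proof -
  interpret M: prob_space M by fact
  note [measurable] = assms(3,8,9,10)
  \<comment> \<open>An infinite set has \<open>card\<close> 0, so a positive cardinality forces
    finiteness.\<close>
  have fin: "finite (W ` \<Xi>)" using assms(11,12) by (simp add: card_ge_0_finite)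
  have "\<forall>A\<in>W ` \<Xi>. \<exists>R. finite R \<and> card R \<le> num_extreme_rays (dual_cone A) \<and>
      (\<forall>b. (\<exists>y. A *v y = b \<and> (\<forall>j. 0 \<le> y $ j)) \<longleftrightarrow> (\<forall>a\<in>R. 0 \<le> a \<bullet> b))"
    using assms(15) by (intro ballI feasible_iff_extreme_rays)
  from bchoice[OF this] obtain R where "\<forall>A\<in>W ` \<Xi>. finite (R A) \<and> card (R A) \<le> num_extreme_rays (dual_cone A) \<and>
      (\<forall>b. (\<exists>y. A *v y = b \<and> (\<forall>j. 0 \<le> y $ j)) \<longleftrightarrow> (\<forall>a\<in>R A. 0 \<le> a \<bullet> b))" ..
  then have R: "\<And>A. A \<in> W ` \<Xi> \<Longrightarrow> finite (R A)"
      "\<And>A. A \<in> W ` \<Xi> \<Longrightarrow> card (R A) \<le> num_extreme_rays (dual_cone A)"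
      "\<And>A b. A \<in> W ` \<Xi> \<Longrightarrow> (\<exists>y. A *v y = b \<and> (\<forall>j. 0 \<le> y $ j)) \<longleftrightarrow> (\<forall>a\<in>R A. 0 \<le> a \<bullet> b)"
    by blast+
  have cardR: "card (R A) \<le> J" if "A \<in> W ` \<Xi>" for A
    using R(2)[OF that] that fin unfolding assms(26) by (meson Max_ge finite_imageI imageI order_trans)
  have W\<Xi>: "W (\<xi> \<omega>) \<in> W ` \<Xi>" if "\<omega> \<in> space M" for \<omega> using assms(4)[OF that] by simp
  \<comment> \<open>Infeasibility described by rays involves only \<open>W\<close>, \<open>T\<close>
    and \<open>h\<close>, so it is measurable on the product itself, whereas \<open>f\<close> is
    measurable only for completions.\<close>
  define C where "C = {(\<omega>, x). \<omega> \<in> space M \<and>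
      (\<exists>a\<in>R (W (\<xi> \<omega>)). a \<bullet> (h (\<xi> \<omega>) - T (\<xi> \<omega>) *v x) < 0)}"
  have infeasible: "(\<omega>, x) \<in> C \<longleftrightarrow> \<not> (\<exists>y. W (\<xi> \<omega>) *v y = h (\<xi> \<omega>) - T (\<xi> \<omega>) *v x \<and> (\<forall>j. 0 \<le> y $ j))"
    if "\<omega> \<in> space M" for \<omega> x
    using R(3)[OF W\<Xi>[OF that]] that by (auto simp: C_def not_le)
  have C: "C \<in> sets (M \<Otimes>\<^sub>M borel)"
  proof -
    define \<W> where "\<W> = W ` \<Xi>"
    have \<W>: "\<omega> \<in> space M \<Longrightarrow> W (\<xi> \<omega>) \<in> \<W>" for \<omega> using W\<Xi> by (simp add: \<W>_def)
    \<comment> \<open>\<open>R\<close> comes from a choice. Splitting over the finitely many values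
      of \<open>W\<close> makes it constant on each piece.\<close>
    have "C = (\<Union>A\<in>\<W>. \<Union>a\<in>R A. {p\<in>space (M \<Otimes>\<^sub>M borel). W (\<xi> (fst p)) = A \<and>
        a \<bullet> h (\<xi> (fst p)) - a \<bullet> (T (\<xi> (fst p)) *v snd p) < 0})"
      by (auto simp: C_def space_pair_measure inner_diff_right dest: \<W>)
    also have "\<dots> \<in> sets (M \<Otimes>\<^sub>M borel)"
    proof (intro sets.finite_UN)
      show "finite \<W>" using fin by (simp add: \<W>_def)
      show "finite (R A)" if "A \<in> \<W>" for A using R(1) that by (simp add: \<W>_def)
      fix A a
      have [measurable]: "(\<lambda>p. a \<bullet> (T (\<xi> (fst p)) *v snd p)) \<in> borel_measurable (M \<Otimes>\<^sub>M borel)"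
        by (rule borel_measurable_inner_matrix_vector_mult) measurable
      show "{p\<in>space (M \<Otimes>\<^sub>M borel). W (\<xi> (fst p)) = A \<and>
        a \<bullet> h (\<xi> (fst p)) - a \<bullet> (T (\<xi> (fst p)) *v snd p) < 0} \<in> sets (M \<Otimes>\<^sub>M borel)"
        by measurable
    qed
    finally show ?thesis .
  qed
  \<comment> \<open>Almost surely \<open>g\<close> is finite, so an infinite value can only come
    from an empty second-stage feasible set.\<close>
  have V_le: "V x \<le> measure M {\<omega>\<in>space M. (\<omega>, x) \<in> C}" for x
    unfolding assms(22) violation_prob_def
  proof (rule M.finite_measure_mono_AE)
    show "{\<omega>\<in>space M. (\<omega>, x) \<in> C} \<in> sets M"
      using measurable_sets[OF measurable_Pair2'[of x borel M] C] by (simp add: vimage_def Int_def conj_commute)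
    show "AE \<omega> in M. \<omega> \<in> {\<omega>\<in>space M. f (\<xi> \<omega>) x = \<infinity>} \<longrightarrow> \<omega> \<in> {\<omega>\<in>space M. (\<omega>, x) \<in> C}"
      using assms(7)
    proof eventually_elim
      case (elim \<omega>)
      show ?case
      proof (rule impI, rule ccontr)
        assume \<omega>: "\<omega> \<in> {\<omega>\<in>space M. f (\<xi> \<omega>) x = \<infinity>}" "\<omega> \<notin> {\<omega>\<in>space M. (\<omega>, x) \<in> C}"
        then obtain y where "W (\<xi> \<omega>) *v y = h (\<xi> \<omega>) - T (\<xi> \<omega>) *v x" "\<forall>j. 0 \<le> y $ j"
          using infeasible by auto
        moreover have "\<bar>g (\<xi> \<omega>) y\<bar> \<noteq> \<infinity>" using elim[THEN conjunct1] by (rule spec)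
        then have "g (\<xi> \<omega>) y < \<infinity>" by auto
        ultimately have "f (\<xi> \<omega>) x < \<infinity>"
          unfolding assms(16) by (rule second_stage_value_less_top)
        with \<omega>(1) show False by simp
      qed
    qed
  qed
  \<comment> \<open>For positive \<open>J\<close> the exponent \<open>2 * N * J * \<alpha>\<close>
    equals \<open>N * \<epsilon> / 4\<close>. For \<open>J = 0\<close> the value 1 makes
    \<open>K\<close> equal to 1.\<close>
  define \<alpha> where "\<alpha> = (if J = 0 then 1 else \<epsilon> / (8 * real J))"
  have \<alpha>: "0 < \<alpha>" "\<alpha> \<le> 1" using assms(28,29) by (auto simp: \<alpha>_def divide_le_eq)
  define K where "K = (1 / \<alpha>) ^ CARD('n) * (1 + \<alpha>) ^ (2 * N * J)"
  have traces: "real (card ((\<lambda>x. {j\<in>{..<2*N}. (s j, x) \<in> C}) ` space borel)) \<le> K"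
    if s: "s \<in> {..<2*N} \<rightarrow> space M" for s
  proof -
    have sW: "j \<in> {..<2*N} \<Longrightarrow> W (\<xi> (s j)) \<in> W ` \<Xi>" for j using s W\<Xi> by auto
    have eq: "(\<lambda>x. {j\<in>{..<2*N}. (s j, x) \<in> C}) = (\<lambda>x. {j\<in>{..<2*N}. \<exists>a\<in>R (W (\<xi> (s j))).
        - (a v* T (\<xi> (s j))) \<bullet> x < - (a \<bullet> h (\<xi> (s j)))})"
      using s by (intro ext Collect_cong) (auto simp: C_def inner_diff_right dot_lmul_matrix)
    have "real (card (range (\<lambda>x. {j\<in>{..<2*N}. (s j, x) \<in> C})))
        \<le> (1 / \<alpha>) ^ DIM(real^'n) * (1 + \<alpha>) ^ (card {..<2*N} * J)"
      unfolding eq by (intro card_traces_le finite_lessThan R(1) cardR sW \<alpha>)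
    then show ?thesis by (simp only: K_def space_borel card_lessThan DIM_cart DIM_real mult_1_right)
  qed
  define Q where "Q = (\<Pi>\<^sub>M i\<in>{..<N}. distr M borel \<xi>)"
  define P where "P = (\<Pi>\<^sub>M i\<in>{..<N}. M)"
  \<comment> \<open>\<open>D\<close> sends a sample of outcomes to the sample of scenarios, so
    \<open>Q\<close> is the image of \<open>P\<close> under \<open>D\<close>.\<close>
  define D where "D = compose {..<N} \<xi>"
  interpret P: prob_space P unfolding P_def by (intro prob_space_PiM M.prob_space_axioms)
  have law: "prob_space (distr M borel \<xi>)" by (intro M.prob_space_distr) measurable
  have PN: "P\<^sub>N = completion Q" by (simp add: assms(23) Q_def)
  have \<xi>': "\<xi> \<in> M \<rightarrow>\<^sub>M distr M borel \<xi>" by simp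
  have "distr P Q D = (\<Pi>\<^sub>M i\<in>{..<N}. distr M (distr M borel \<xi>) \<xi>)"
    unfolding P_def Q_def D_def
    by (rule distr_PiM_finite_prob_space') (use law M.prob_space_axioms \<xi>' in auto)
  also have "distr M (distr M borel \<xi>) \<xi> = distr M borel \<xi>" by (rule distr_cong) auto
  finally have distrD: "distr P Q D = Q" by (simp add: Q_def)
  have D[measurable]: "D \<in> P \<rightarrow>\<^sub>M Q"
    unfolding D_def P_def Q_def compose_def using \<xi>'
    by (intro measurable_restrict measurable_compose[OF measurable_component_singleton]) auto
  \<comment> \<open>\<open>D\<close> is measurable into \<open>Q\<close>, not its completion, so the
    output is replaced by a version measurable for \<open>Q\<close> before composing.\<close>
  obtain x' where x'[measurable]: "x' \<in> borel_measurable Q" and x'_eq: "AE s in Q. xstar s = x' s"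
    using completion_ex_borel_measurable_euclidean assms(24) PN by blast
  define Y where "Y s = x' (D s)" for s
  have Y[measurable]: "Y \<in> P \<rightarrow>\<^sub>M borel" unfolding Y_def by measurable
  define E where "E = {s \<in> space P. (\<forall>i<N. (s i, Y s) \<notin> C) \<and>
      \<epsilon> < measure M {z\<in>space M. (z, Y s) \<in> C}}"
  have "0 \<le> K" using \<alpha> by (simp add: K_def)
  note core = M.consistent_violation_le[OF Y[unfolded P_def] C traces less_imp_le[OF assms(28)] this,
      folded P_def, folded E_def]
  have transfer: "measure P\<^sub>N {s \<in> space P\<^sub>N. V (xstar s) > \<epsilon>} \<le> measure P E"
  proof (cases "{s \<in> space P\<^sub>N. V (xstar s) > \<epsilon>} \<in> sets P\<^sub>N")
    \<comment> \<open>\<open>measure\<close> is 0 on a set that is not measurable.\<close>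
    case False
    then show ?thesis by (simp add: measure_notin_sets)
  next
    case True
    \<comment> \<open>The main part lies in \<open>sets Q\<close> and differs from the event by a
      null set, so it can be pulled back along \<open>D\<close>.\<close>
    define A where "A = main_part Q {s \<in> space P\<^sub>N. V (xstar s) > \<epsilon>}"
    have A[measurable]: "A \<in> sets Q" using True by (simp add: A_def PN main_part_sets)
    have A_sub: "V (xstar s) > \<epsilon>" if "s \<in> A" for s
      using that main_part_null_part_Un[OF True[unfolded PN]] by (auto simp: A_def PN)
    have "measure P\<^sub>N {s \<in> space P\<^sub>N. V (xstar s) > \<epsilon>} = measure Q A"
      using True by (simp add: A_def PN measure_def)
    also have "\<dots> = measure P (D -` A \<inter> space P)"
      by (subst distrD[symmetric]) (rule measure_distr[OF D A])
    also have "\<dots> \<le> measure P E"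
    proof (rule P.finite_measure_mono_AE[OF _ core(1)])
      have "AE s in distr P Q D. xstar s \<in> saa_feasible X f N s \<and> xstar s = x' s"
        unfolding distrD using assms(25)[unfolded PN AE_completion_iff] x'_eq by (rule eventually_conj)
      then have "AE s in P. xstar (D s) \<in> saa_feasible X f N (D s) \<and> xstar (D s) = Y s"
        unfolding Y_def by (rule AE_distrD[OF D])
      then show "AE s in P. s \<in> D -` A \<inter> space P \<longrightarrow> s \<in> E"
      proof eventually_elim
        case (elim s)
        show ?case
        proof
          assume s: "s \<in> D -` A \<inter> space P"
          have "(s i, Y s) \<notin> C" if "i < N" for i
          proof -
            have "(s i, Y s) \<in> C \<longleftrightarrow> \<not> (\<exists>y. W (\<xi> (s i)) *v y = h (\<xi> (s i)) - T (\<xi> (s i)) *v Y s \<and> (\<forall>j. 0 \<le> y $ j))"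
              using s that by (intro infeasible) (auto simp: P_def space_PiM)
            moreover have "f (\<xi> (s i)) (Y s) < \<infinity>"
              using elim that by (auto simp: saa_feasible_def D_def compose_def)
            then have "\<exists>y. W (\<xi> (s i)) *v y = h (\<xi> (s i)) - T (\<xi> (s i)) *v Y s \<and> (\<forall>j. 0 \<le> y $ j)"
              unfolding assms(16) by (rule second_stage_value_less_top_imp)
            ultimately show ?thesis by simp
          qed
          moreover have "\<epsilon> < V (Y s)" using A_sub[of "D s"] s elim by simp
          ultimately show "s \<in> E" using V_le[of "Y s"] s by (auto simp: E_def)
        qed
      qed
    qed
    finally show ?thesis .
  qed
  have rate: "measure P\<^sub>N {s \<in> space P\<^sub>N. V (xstar s) > \<epsilon>}
      \<le> 2 * exp (- (real N * \<epsilon> / 4)) * (12 / \<epsilon>) powr d\<^sub>V\<^sub>C"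
  proof -
    \<comment> \<open>Symmetrisation gains \<open>exp (N * \<epsilon> / 2)\<close> and the number of
      traces costs \<open>exp (N * \<epsilon> / 4)\<close>. The quotient is the claimed
      rate.\<close>
    have "exp (real N * \<epsilon> / 2) * measure P E = exp (\<epsilon> / 2) ^ N * measure P E"
      by (simp add: exp_of_nat_mult[symmetric])
    also have "\<dots> \<le> (1 + \<epsilon>) ^ N * measure P E"
      using assms(28,29) by (intro mult_right_mono power_mono exp_half_le_one_plus) auto
    also have "\<dots> \<le> K" by (rule core(2))
    also have "\<dots> \<le> (12 / \<epsilon>) powr d\<^sub>V\<^sub>C * exp (real N * \<epsilon> / 4)"
      unfolding K_def
    proof (intro mult_mono)
      show "(1 / \<alpha>) ^ CARD('n) \<le> (12 / \<epsilon>) powr d\<^sub>V\<^sub>C"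
        unfolding assms(27) \<alpha>_def by (rule inverse_power_le_powr_vc_bound[OF assms(28,29)])
      have "(1 + \<alpha>) ^ (2 * N * J) \<le> exp \<alpha> ^ (2 * N * J)"
        using \<alpha> by (intro power_mono exp_ge_add_one_self) auto
      also have "\<dots> = exp (real (2 * N * J) * \<alpha>)" by (simp only: exp_of_nat_mult)
      also have "\<dots> \<le> exp (real N * \<epsilon> / 4)"
        using assms(28) by (auto simp: \<alpha>_def)
      finally show "(1 + \<alpha>) ^ (2 * N * J) \<le> exp (real N * \<epsilon> / 4)" .
    qed (use \<alpha> in auto)
    finally have "measure P E \<le> (12 / \<epsilon>) powr d\<^sub>V\<^sub>C * (exp (real N * \<epsilon> / 4) / exp (real N * \<epsilon> / 2))"
      by (simp add: field_simps)
    also have "exp (real N * \<epsilon> / 4) / exp (real N * \<epsilon> / 2) = exp (- (real N * \<epsilon> / 4))"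
      by (simp add: exp_diff[symmetric])
    also have "(12 / \<epsilon>) powr d\<^sub>V\<^sub>C * exp (- (real N * \<epsilon> / 4))
        \<le> 2 * exp (- (real N * \<epsilon> / 4)) * (12 / \<epsilon>) powr d\<^sub>V\<^sub>C" by simp
    finally show ?thesis using transfer by linarith
  qed
  have "measure P\<^sub>N {s \<in> space P\<^sub>N. V (xstar s) > \<epsilon>} \<le> \<delta>"
    if \<delta>: "0 < \<delta>" "\<delta> < 1" and N: "real N \<ge> 4 / \<epsilon> * (d\<^sub>V\<^sub>C * ln (12 / \<epsilon>) + ln (2 / \<delta>))" for \<delta>
  proof -
    have "d\<^sub>V\<^sub>C * ln (12 / \<epsilon>) + ln (2 / \<delta>) \<le> real N * \<epsilon> / 4"
      using N assms(28) by (simp add: field_simps)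
    then have "2 * exp (- (real N * \<epsilon> / 4) + d\<^sub>V\<^sub>C * ln (12 / \<epsilon>)) \<le> 2 * exp (- ln (2 / \<delta>))"
      by simp
    also have "\<dots> = \<delta>" using \<delta> by (simp add: exp_minus)
    also have "2 * exp (- (real N * \<epsilon> / 4) + d\<^sub>V\<^sub>C * ln (12 / \<epsilon>))
        = 2 * exp (- (real N * \<epsilon> / 4)) * (12 / \<epsilon>) powr d\<^sub>V\<^sub>C"
      unfolding exp_add powr_def using assms(28) by simp
    finally show ?thesis using rate by linarith
  qed
  with rate show ?thesis by blast
qed

end
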